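(* Let $R$ be a finite Frobenius ring and let $C\leq{}_RR^n$ be a modular two-weight code of index $r$ with nonzero homogeneous weights $w_1<w_2$ and with $C_0=\{\mathbf{0}\}$. Let $b_1=|C_1|$. Then the dual $C'\leq R^{b_1}_R$ of the two-weight code $C$ is also a (modular) two-weight code, it satisfies $C'_0=\{\mathbf{0}\}$, and its nonzero homogeneous weights are $$w_1'=\frac{(w_2-n-r)|C|}{w_2-w_1}=\frac{b_1w_1}{n},\qquad w_2'=\frac{(w_2-n)|C|}{w_2-w_1}.$$
   Context: A finite ring $R$ (with $1$, unit group $R^\times$) is a Frobenius ring if there is a character $\chi\in\mathrm{Hom}_{\mathbb{Z}}(R,\mathbb{C}^\times)$ of $(R,+)$ whose kernel contains no nonzero left (or right) ideal of $R$. The (normalized) homogeneous weight is $w_{\mathrm{hom}}(x)=1-\frac{1}{|R^\times|}\sum_{u\in R^\times}\chi(ux)$ for $x\in R$ (independent of the choice of $\chi$; it takes real values $\ge 0$), extended to $R^n$ by $w_{\mathrm{hom}}(\mathbf{x})=\sum_{j=1}^n w_{\mathrm{hom}}(x_j)$. A (left) linear code $C\leq{}_RR^n$ is a submodule of the left module ${}_RR^n$; a right linear code is a submodule of the right module $R^m_R$. Points of the projective geometry $\mathrm{PG}(R^k_R)$ are the nonzero cyclic submodules $\mathbf{g}R$ of the free right module $R^k_R$ (column vectors). If $C$ is a left linear code with no all-zero coordinate and $C=\{\mathbf{x}\mathbf{G};\mathbf{x}\in R^k\}$ with $\mathbf{G}=(\mathbf{g}_1|\dots|\mathbf{g}_n)\in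 R^{k\times n}$, put $\alpha_C(\mathbf{g}R)=|\{j;1\le j\le n,\ \mathbf{g}_jR=\mathbf{g}R\}|$ for every point $\mathbf{g}R$. Such a code $C$ is modular of index $r$ if $r\in\mathbb{Q}$ and for every point $\mathbf{g}R$ either $\alpha_C(\mathbf{g}R)=0$ or $\alpha_C(\mathbf{g}R)=r\,|\mathbf{g}R^\times|$. (This does not depend on the choice of $k$ and $\mathbf{G}$.) Modularity of right linear codes is defined in the same way with left and right interchanged: for a code $\{\mathbf{H}\mathbf{y};\mathbf{y}\in R^k\}\leq R^m_R$ with no all-zero coordinate, where $\mathbf{H}\in R^{m\times k}$ has rows $\mathbf{h}_1,\dots,\mathbf{h}_m$, one requires that for every nonzero $\mathbf{h}\in R^k$ the number of $j$ with $R\mathbf{h}_j=R\mathbf{h}$ is either $0$ or $r\,|R^\times\mathbf{h}|$. A code is modular if it is modular of some index. A two-weight code is a (left or right) linear code $C$ whose codewords take exactly two distinct nonzero homogeneous weights $w_1<w_2$. Put $C_0=\{\mathbf{c}\in C;w_{\mathrm{hom}}(\mathbf{c})=0\}$ and $C_i=\{\mathbf{c}\in C;w_{\mathrm{hom}}(\mathbf{c})=w_i\}$, $b_i=|C_i|$ for $i=1,2$. Likewise $C'_0$ is the set of words of $C'$ of homogeneous weight $0$. Dual of a two-weight code: let $\mathbf{M}_1\in R^{b_1\times n}$ be a matrix whose rows are the codewords of $C$ of weight $w_1$, in some order. The dual $C'$ of $C$ is the right linear code $C'\leq R^{b_1}_R$ generated by the columns of $\mathbf{M}_1$. *)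

theory Defs
  imports Complex_Main "Jordan_Normal_Form.Matrix"
begin

text \<open>
  A finite ring is a type of class ring_1 and finite; it need not be commutative.
  Row vectors (words of a left code) and column vectors are both rendered by the vector type
  of the matrix library. The left action of a scalar on a vector is \<open>\<cdot>\<^sub>v\<close>; the right action and
  the product of a row vector with a matrix are defined here, keeping the order of the factors.
\<close>

section \<open>Frobenius rings and the homogeneous weight\<close>

definition ring_units :: "'a::ring_1 set" where
  "ring_units = {u. \<exists>v. u * v = 1 \<and> v * u = 1}"

definition left_ideal :: "'a::ring_1 set \<Rightarrow> bool" where
  "left_ideal I \<longleftrightarrow> 0 \<in> I \<and> (\<forall>x\<in>I. \<forall>y\<in>I. x + y \<in> I) \<and> (\<forall>a. \<forall>x\<in>I. a * x \<in> I)"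

definition additive_character :: "('a::ring_1 \<Rightarrow> complex) \<Rightarrow> bool" where
  "additive_character \<chi> \<longleftrightarrow> (\<forall>x. \<chi> x \<noteq> 0) \<and> (\<forall>x y. \<chi> (x + y) = \<chi> x * \<chi> y)"

text \<open>For finite rings the same condition with right ideals is equivalent.\<close>

definition generating_character :: "('a::ring_1 \<Rightarrow> complex) \<Rightarrow> bool" where
  "generating_character \<chi> \<longleftrightarrow> additive_character \<chi> \<and>
     (\<forall>I. left_ideal I \<and> I \<subseteq> {x. \<chi> x = 1} \<longrightarrow> I = {0})"

definition frobenius_ring :: "'a::{ring_1, finite} itself \<Rightarrow> bool" where
  "frobenius_ring _ \<longleftrightarrow> (\<exists>\<chi> :: 'a \<Rightarrow> complex. generating_character \<chi>)"

text \<open>Taking the real part loses nothing, see \<open>of_real_hom_weight\<close> below.\<close>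

definition hom_weight :: "('a::{ring_1, finite} \<Rightarrow> complex) \<Rightarrow> 'a \<Rightarrow> real" where
  "hom_weight \<chi> x =
     Re (1 - (1 / of_nat (card (ring_units :: 'a set))) * (\<Sum>u\<in>ring_units. \<chi> (u * x)))"

definition word_weight :: "('a::{ring_1, finite} \<Rightarrow> complex) \<Rightarrow> 'a vec \<Rightarrow> real" where
  "word_weight \<chi> c = (\<Sum>j<dim_vec c. hom_weight \<chi> (c $ j))"

lemma additive_character_0:
  assumes "additive_character \<chi>"
  shows "\<chi> 0 = 1"
proof -
  have "\<chi> 0 * \<chi> 0 = \<chi> 0 * 1" "\<chi> 0 \<noteq> 0"
    using assms unfolding additive_character_def by (metis add_0 mult_1_right)+
  then show ?thesis by simp
qed

lemma additive_character_uminus: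
  fixes \<chi> :: "'a::{ring_1, finite} \<Rightarrow> complex"
  assumes "additive_character \<chi>"
  shows "\<chi> (- x) = cnj (\<chi> x)"
proof -
  have add: "\<chi> (x + y) = \<chi> x * \<chi> y" and nz: "\<chi> x \<noteq> 0" for x y
    using assms by (auto simp: additive_character_def)
  have inv: "\<chi> x * \<chi> (- x) = 1" for x
    using add[of x "- x"] additive_character_0[OF assms] by simp
  define m where "m = Max (range (\<lambda>y. cmod (\<chi> y)))"
  have "m \<in> range (\<lambda>y. cmod (\<chi> y))"
    unfolding m_def by (rule Max_in) auto
  then obtain y where y: "m = cmod (\<chi> y)" by blast
  have le: "cmod (\<chi> z) \<le> 1" for z
  proof -
    have "cmod (\<chi> (z + y)) \<le> m" unfolding m_def by (rule Max_ge) auto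
    then have "cmod (\<chi> z) * m \<le> 1 * m" by (simp add: add norm_mult y)
    moreover have "m > 0" using nz y by simp
    ultimately show ?thesis by simp
  qed
  have "cmod (\<chi> x) * cmod (\<chi> (- x)) = 1"
    by (metis inv norm_mult norm_one)
  then have "cmod (\<chi> x) = 1"
    using le[of x] le[of "- x"] mult_left_le[of "cmod (\<chi> (- x))" "cmod (\<chi> x)"] by simp
  then have "\<chi> x * cnj (\<chi> x) = 1"
    by (simp add: complex_norm_square[symmetric])
  then have "\<chi> x * cnj (\<chi> x) = \<chi> x * \<chi> (- x)" by (simp add: inv)
  then show ?thesis using nz by simp
qed

lemma of_real_hom_weight:
  fixes \<chi> :: "'a::{ring_1, finite} \<Rightarrow> complex"
  assumes "additive_character \<chi>"
  shows "complex_of_real (hom_weight \<chi> x) =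
    1 - (1 / of_nat (card (ring_units :: 'a set))) * (\<Sum>u\<in>ring_units. \<chi> (u * x))"
proof -
  have inv: "u \<in> ring_units \<Longrightarrow> - u \<in> ring_units" for u :: 'a
    unfolding ring_units_def by (auto intro: exI[of _ "- v" for v])
  have "(\<Sum>u\<in>ring_units. \<chi> (u * x)) = (\<Sum>u\<in>ring_units. \<chi> (- (u * x)))"
    by (rule sum.reindex_bij_witness[of _ uminus uminus]) (auto simp: inv)
  also have "\<dots> = cnj (\<Sum>u\<in>ring_units. \<chi> (u * x))"
    by (simp add: additive_character_uminus[OF assms])
  finally have "(\<Sum>u\<in>ring_units. \<chi> (u * x)) \<in> \<real>"
    by (simp add: Reals_cnj_iff)
  then have "1 - (1 / of_nat (card (ring_units :: 'a set))) * (\<Sum>u\<in>ring_units. \<chi> (u * x)) \<in> \<real>"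
    by (intro Reals_diff Reals_mult Reals_divide) auto
  then show ?thesis by (simp only: hom_weight_def of_real_Re)
qed

section \<open>Linear codes\<close>

abbreviation smult_right :: "'a::ring_1 vec \<Rightarrow> 'a \<Rightarrow> 'a vec" where
  "smult_right v a \<equiv> map_vec (\<lambda>x. x * a) v"

definition vec_mult_mat :: "'a::ring_1 vec \<Rightarrow> 'a mat \<Rightarrow> 'a vec" where
  "vec_mult_mat x G = vec (dim_col G) (\<lambda>j. x \<bullet> col G j)"

definition left_linear_code :: "nat \<Rightarrow> 'a::ring_1 vec set \<Rightarrow> bool" where
  "left_linear_code n C \<longleftrightarrow> C \<subseteq> carrier_vec n \<and> 0\<^sub>v n \<in> C \<and>
     (\<forall>x\<in>C. \<forall>y\<in>C. x + y \<in> C) \<and> (\<forall>a. \<forall>x\<in>C. a \<cdot>\<^sub>v x \<in> C)"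

definition right_linear_code :: "nat \<Rightarrow> 'a::ring_1 vec set \<Rightarrow> bool" where
  "right_linear_code m C \<longleftrightarrow> C \<subseteq> carrier_vec m \<and> 0\<^sub>v m \<in> C \<and>
     (\<forall>x\<in>C. \<forall>y\<in>C. x + y \<in> C) \<and> (\<forall>a. \<forall>x\<in>C. smult_right x a \<in> C)"

definition no_zero_coordinate :: "nat \<Rightarrow> 'a::ring_1 vec set \<Rightarrow> bool" where
  "no_zero_coordinate n C \<longleftrightarrow> (\<forall>j<n. \<exists>c\<in>C. c $ j \<noteq> 0)"

section \<open>Modular codes\<close>

definition right_cyclic :: "'a::ring_1 vec \<Rightarrow> 'a vec set" where
  "right_cyclic g = range (\<lambda>a. smult_right g a)"

definition left_cyclic :: "'a::ring_1 vec \<Rightarrow> 'a vec set" where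
  "left_cyclic h = range (\<lambda>a. a \<cdot>\<^sub>v h)"

text \<open>
  The points \<open>gR\<close> are represented by the nonzero vectors \<open>g\<close>. Since the property does not depend
  on the choice of \<open>k\<close> and of the generating matrix, it is stated for some such choice; the rows
  of the matrix are not required to be independent, so such a matrix always exists.
\<close>

definition left_modular_code :: "nat \<Rightarrow> 'a::{ring_1, finite} vec set \<Rightarrow> real \<Rightarrow> bool" where
  "left_modular_code n C r \<longleftrightarrow> left_linear_code n C \<and> no_zero_coordinate n C \<and> r \<in> \<rat> \<and>
     (\<exists>k. \<exists>G \<in> carrier_mat k n. C = {vec_mult_mat x G | x. x \<in> carrier_vec k} \<and>
       (\<forall>g \<in> carrier_vec k. g \<noteq> 0\<^sub>v k \<longrightarrow>
          (let \<alpha> = card {j. j < n \<and> right_cyclic (col G j) = right_cyclic g}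
           in \<alpha> = 0 \<or> real \<alpha> = r * real (card {smult_right g u | u. u \<in> ring_units}))))"

definition right_modular_code :: "nat \<Rightarrow> 'a::{ring_1, finite} vec set \<Rightarrow> real \<Rightarrow> bool" where
  "right_modular_code m C r \<longleftrightarrow> right_linear_code m C \<and> no_zero_coordinate m C \<and> r \<in> \<rat> \<and>
     (\<exists>k. \<exists>H \<in> carrier_mat m k. C = {H *\<^sub>v y | y. y \<in> carrier_vec k} \<and>
       (\<forall>h \<in> carrier_vec k. h \<noteq> 0\<^sub>v k \<longrightarrow>
          (let \<alpha> = card {j. j < m \<and> left_cyclic (row H j) = left_cyclic h}
           in \<alpha> = 0 \<or> real \<alpha> = r * real (card {u \<cdot>\<^sub>v h | u. u \<in> ring_units}))))"

section \<open>Two-weight codes and their duals\<close>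

definition words_of_weight ::
    "('a::{ring_1, finite} \<Rightarrow> complex) \<Rightarrow> 'a vec set \<Rightarrow> real \<Rightarrow> 'a vec set" where
  "words_of_weight \<chi> C w = {c \<in> C. word_weight \<chi> c = w}"

definition two_weights ::
    "('a::{ring_1, finite} \<Rightarrow> complex) \<Rightarrow> 'a vec set \<Rightarrow> real \<Rightarrow> real \<Rightarrow> bool" where
  "two_weights \<chi> C w1 w2 \<longleftrightarrow> w1 < w2 \<and> word_weight \<chi> ` C - {0} = {w1, w2}"

definition left_two_weight_code ::
    "('a::{ring_1, finite} \<Rightarrow> complex) \<Rightarrow> nat \<Rightarrow> 'a vec set \<Rightarrow> real \<Rightarrow> real \<Rightarrow> bool" where
  "left_two_weight_code \<chi> n C w1 w2 \<longleftrightarrow> left_linear_code n C \<and> two_weights \<chi> C w1 w2"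

definition right_two_weight_code ::
    "('a::{ring_1, finite} \<Rightarrow> complex) \<Rightarrow> nat \<Rightarrow> 'a vec set \<Rightarrow> real \<Rightarrow> real \<Rightarrow> bool" where
  "right_two_weight_code \<chi> m C w1 w2 \<longleftrightarrow> right_linear_code m C \<and> two_weights \<chi> C w1 w2"

text \<open>The right linear code generated by the columns of the matrix \<open>M\<close>.\<close>

definition right_column_code :: "'a::ring_1 mat \<Rightarrow> 'a vec set" where
  "right_column_code M = (right_linear_code (dim_row M)) hull (set (cols M))"

definition is_two_weight_dual ::
    "('a::{ring_1, finite} \<Rightarrow> complex) \<Rightarrow> nat \<Rightarrow> 'a vec set \<Rightarrow> real \<Rightarrow> 'a vec set \<Rightarrow> bool" where
  "is_two_weight_dual \<chi> n C w1 C' \<longleftrightarrow>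
     (\<exists>M1 \<in> carrier_mat (card (words_of_weight \<chi> C w1)) n.
        distinct (rows M1) \<and> set (rows M1) = words_of_weight \<chi> C w1 \<and> C' = right_column_code M1)"

end

theory Submission
  imports Defs
begin

text \<open>
  Let \<open>F y\<close> be the sum of \<open>\<chi> (c \<bullet> y)\<close> over the words \<open>c\<close> of weight \<open>w1\<close>. Since \<open>C1\<close> is stable under
  units, the word \<open>M1 y\<close> of the dual has weight \<open>b1 - F y\<close>. As the weight takes only the values
  \<open>0, w1, w2\<close> on \<open>C\<close>, the function \<open>(w2 - w1) F\<close> is, up to the constant \<open>w2\<close>, the Fourier transform
  of \<open>w2 - w\<close> on \<open>C\<close>. Expanding \<open>w\<close> by its definition, with units moved to the right of the
  coordinates, this transform at \<open>y\<close> off the orthogonal of \<open>C\<close> counts the pairs \<open>(j, u)\<close> with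
  \<open>g\<^sub>j u = - G y\<close>, and modularity says that the count is \<open>0\<close> or \<open>r |R\<^sup>\<times>|\<close>. Hence there are only two
  nonzero weights; both occur, the first at the unit vectors and the second by Fourier inversion.
  Summing the weights of the columns of \<open>M1\<close> gives \<open>n w1' = b1 w1\<close>. Finally \<open>M1\<close> itself shows that
  the dual is modular of index \<open>1\<close>, its rows being a union of unit orbits, each row occurring once.

  Two facts about the ring are needed: generators of the same cyclic module differ by a unit, and
  the unit averages of \<open>\<chi> (u x)\<close> and \<open>\<chi> (x u)\<close> agree.
\<close>

section \<open>Units and generators of cyclic modules\<close>

text \<open>Since \<open>a\<close> undoes left multiplication by \<open>b\<close>, that map is
  injective and, by finiteness, surjective. So \<open>b\<close> has a right inverse as well, and it
  must equal \<open>a\<close>.\<close>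

lemma finite_right_inverse_comm:
  fixes a b :: "'a::{ring_1, finite}"
  assumes "a * b = 1"
  shows "b * a = 1"
proof -
  have "inj ((*) b)"
    by (rule injI) (metis assms mult.assoc mult_1_left)
  then have "surj ((*) b)"
    by (simp add: finite_UNIV_inj_surj)
  then obtain c where c: "1 = b * c"
    by (metis surjD)
  then have "a = c"
    by (metis assms mult.assoc mult_1_left mult_1_right)
  then show ?thesis using c by simp
qed

lemma ring_unitsI:
  fixes a b :: "'a::{ring_1, finite}"
  assumes "a * b = 1"
  shows "a \<in> ring_units" "b \<in> ring_units"
  using assms finite_right_inverse_comm[OF assms] by (auto simp: ring_units_def)

lemma ring_unitsE:
  assumes "u \<in> ring_units"
  obtains v where "v \<in> ring_units" "u * v = 1" "v * u = 1"
  using assms by (auto simp: ring_units_def)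

lemma one_in_ring_units [simp]: "1 \<in> ring_units"
  by (auto simp: ring_units_def)

lemma mult_in_ring_units:
  assumes "u \<in> ring_units" "v \<in> ring_units"
  shows "u * v \<in> ring_units"
proof -
  obtain u' where u': "u * u' = 1" "u' * u = 1" using assms(1) by (rule ring_unitsE)
  obtain v' where v': "v * v' = 1" "v' * v = 1" using assms(2) by (rule ring_unitsE)
  have "(u * v) * (v' * u') = 1" "(v' * u') * (u * v) = 1"
    using u' v' by (metis mult.assoc mult_1_left)+
  then show ?thesis by (auto simp: ring_units_def)
qed

lemma card_ring_units_pos: "card (ring_units :: 'a::{ring_1, finite} set) > 0"
  using one_in_ring_units by (force simp: card_gt_0_iff simp del: one_in_ring_units)

lemma bij_betw_mult_left_ring_units:
  fixes v :: "'a::{ring_1, finite}"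
  assumes "v \<in> ring_units"
  shows "bij_betw ((*) v) ring_units ring_units"
proof -
  obtain v' where v': "v' \<in> ring_units" "v * v' = 1" "v' * v = 1"
    using assms by (rule ring_unitsE)
  show ?thesis
    by (rule bij_betw_byWitness[of _ "(*) v'"])
      (use assms v' mult_in_ring_units in \<open>auto simp: mult.assoc[symmetric]\<close>)
qed

lemma bij_betw_mult_right_ring_units:
  fixes v :: "'a::{ring_1, finite}"
  assumes "v \<in> ring_units"
  shows "bij_betw (\<lambda>u. u * v) ring_units ring_units"
proof -
  obtain v' where v': "v' \<in> ring_units" "v * v' = 1" "v' * v = 1"
    using assms by (rule ring_unitsE)
  show ?thesis
    by (rule bij_betw_byWitness[of _ "\<lambda>u. u * v'"])
      (use assms v' mult_in_ring_units in \<open>auto simp: mult.assoc\<close>)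
qed

text \<open>Reindexing along \<open>t\<close> multiplies the sum by \<open>z\<close>, a factor other
  than 1. The vanishing cases of all the character sums below are obtained in this way, with a
  translation as \<open>t\<close>.\<close>

lemma sum_eq_0_if_scaled:
  fixes \<psi> :: "'b \<Rightarrow> complex"
  assumes "bij_betw t A A" "\<And>x. x \<in> A \<Longrightarrow> \<psi> (t x) = z * \<psi> x" "z \<noteq> 1"
  shows "sum \<psi> A = 0"
proof -
  have "sum \<psi> A = (\<Sum>x\<in>A. \<psi> (t x))"
    using sum.reindex_bij_betw[OF assms(1), of \<psi>] by simp
  also have "\<dots> = z * sum \<psi> A"
    by (simp add: assms(2) sum_distrib_left)
  finally show ?thesis using assms(3) by simp
qed

text \<open>Gaschuetz' counting argument: for a right ideal \<open>L\<close> with \<open>gL = gR = hR\<close>, the number of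
  generators \<open>x\<close> of \<open>L\<close> with \<open>gx = h\<close> does not depend on the choice of \<open>h\<close> among the generators of
  \<open>gR\<close>, and for \<open>L = R\<close>, \<open>h = g\<close> it is positive because of \<open>x = 1\<close>. The multiplication is a
  parameter so that the opposite ring is covered too.\<close>

lemma generator_lifting:
  fixes mul :: "'a::{ring_1, finite} \<Rightarrow> 'a \<Rightarrow> 'a" and act :: "'v \<Rightarrow> 'a \<Rightarrow> 'v"
  assumes assoc: "\<And>a b c. mul (mul a b) c = mul a (mul b c)"
    and one_left: "\<And>a. mul 1 a = a" and one_right: "\<And>a. mul a 1 = a"
    and distrib: "\<And>a b c. mul a (b + c) = mul a b + mul a c"
    and act_mul: "\<And>v a b. act v (mul a b) = act (act v a) b"
    and act_one: "\<And>v. act v 1 = v"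
    and act_add: "\<And>v a b c. act v a = act v b \<Longrightarrow> act v (a + c) = act v (b + c)"
    and gen: "range (act g) = range (act h)"
  shows "\<exists>x. range (mul x) = UNIV \<and> act g x = h"
proof -
  \<comment> \<open>\<open>N L v\<close> counts the generators of the ideal \<open>L\<close> that
    send \<open>g\<close> to \<open>v\<close>. The family \<open>\<L>\<close> consists of the
    principal ideals that still carry \<open>g\<close> onto its whole cyclic module.\<close>
  define N where "N L v = card {x. range (mul x) = L \<and> act g x = v}" for L v
  define \<L> where "\<L> = {L. (\<exists>z. L = range (mul z)) \<and> act g ` L = range (act g)}"
  have fin: "finite A" for A :: "'a set set"
    by (rule finite_subset[of _ "Pow UNIV"]) auto
  \<comment> \<open>The elements of \<open>L\<close> sending \<open>g\<close> to \<open>v\<close>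
    are sorted by the ideal they generate. That ideal lies in \<open>L\<close>, and it belongs to
    \<open>\<L>\<close> because \<open>v\<close> generates the same cyclic module as
    \<open>g\<close>.\<close>
  have count: "card {x \<in> L. act g x = v} = (\<Sum>L'\<in>{L' \<in> \<L>. L' \<subseteq> L}. N L' v)"
    if L: "L \<in> \<L>" and v: "range (act v) = range (act g)" for L v
  proof -
    obtain z where z: "L = range (mul z)" using L by (auto simp: \<L>_def)
    have "{x \<in> L. act g x = v} = (\<Union>L'\<in>{L' \<in> \<L>. L' \<subseteq> L}. {x. range (mul x) = L' \<and> act g x = v})"
    proof (intro equalityI subsetI)
      fix x assume "x \<in> {x \<in> L. act g x = v}"
      then have x: "x \<in> L" "act g x = v" by auto
      have "range (mul x) \<subseteq> L" using x(1) assoc unfolding z by auto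
      moreover have "act g ` range (mul x) = range (act g)"
        using v x(2) by (simp add: image_image act_mul)
      ultimately show "x \<in> (\<Union>L'\<in>{L' \<in> \<L>. L' \<subseteq> L}. {x. range (mul x) = L' \<and> act g x = v})"
        using x(2) by (auto simp: \<L>_def)
    next
      fix x assume "x \<in> (\<Union>L'\<in>{L' \<in> \<L>. L' \<subseteq> L}. {x. range (mul x) = L' \<and> act g x = v})"
      then show "x \<in> {x \<in> L. act g x = v}"
        using rangeI[of "mul x" 1] by (auto simp: one_right)
    qed
    then show ?thesis
      unfolding N_def by (simp only:) (rule card_UN_disjoint; auto simp: fin)
  qed
  \<comment> \<open>The two fibres are translates of each other by \<open>x1 - x0\<close>, where
    \<open>x0\<close> and \<open>x1\<close> in \<open>L\<close> send \<open>g\<close> to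
    \<open>h\<close> and to \<open>g\<close>.\<close>
  have same: "card {x \<in> L. act g x = h} = card {x \<in> L. act g x = g}" if L: "L \<in> \<L>" for L
  proof -
    obtain z where z: "L = range (mul z)" using L by (auto simp: \<L>_def)
    have cl: "a + b \<in> L" if "a \<in> L" "b \<in> L" for a b
      using that unfolding z by (auto simp: distrib[symmetric])
    have zero: "mul z 0 = 0" using distrib[of z 0 0] by simp
    have clm: "- a \<in> L" if a: "a \<in> L" for a
    proof -
      obtain y where "a = mul z y" using a z by auto
      then have "- a = mul z (- y)" using distrib[of z y "- y"] zero
        by (simp add: add_eq_0_iff)
      then show ?thesis by (simp add: z)
    qed
    have cld: "a - b \<in> L" if "a \<in> L" "b \<in> L" for a b
      using cl[OF that(1) clm[OF that(2)]] by simp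
    have "h \<in> act g ` L" "g \<in> act g ` L"
      using L gen rangeI[of "act g" 1] rangeI[of "act h" 1] unfolding \<L>_def by (auto simp: act_one)
    then obtain x0 x1 where x: "x0 \<in> L" "act g x0 = h" "x1 \<in> L" "act g x1 = g" by auto
    show ?thesis
    proof (rule bij_betw_same_card[of "\<lambda>x. x + (x1 - x0)"],
        rule bij_betw_byWitness[of _ "\<lambda>x. x + (x0 - x1)"])
      show "(\<lambda>x. x + (x1 - x0)) ` {x \<in> L. act g x = h} \<subseteq> {x \<in> L. act g x = g}"
        using act_add[of g _ x0 "x1 - x0"] x cl cld by auto
      show "(\<lambda>x. x + (x0 - x1)) ` {x \<in> L. act g x = g} \<subseteq> {x \<in> L. act g x = h}"
        using act_add[of g _ x1 "x0 - x1"] x cl cld by auto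
    qed auto
  qed
  \<comment> \<open>By \<open>count\<close> and \<open>same\<close> the totals over all ideals of
    \<open>\<L>\<close> inside \<open>L\<close> agree for \<open>h\<close> and \<open>g\<close>. The
    induction hypothesis cancels the proper ones and leaves the term of \<open>L\<close>
    itself.\<close>
  have eq: "L \<in> \<L> \<Longrightarrow> N L h = N L g" for L
  proof (induction "card L" arbitrary: L rule: less_induct)
    case (less L)
    have split: "{L' \<in> \<L>. L' \<subseteq> L} = insert L {L' \<in> \<L>. L' \<subset> L}"
      using less(2) by auto
    have "(\<Sum>L'\<in>{L' \<in> \<L>. L' \<subseteq> L}. N L' h) = (\<Sum>L'\<in>{L' \<in> \<L>. L' \<subseteq> L}. N L' g)"
      using count[OF less(2) gen[symmetric]] count[OF less(2) refl] same[OF less(2)] by simp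
    moreover have "(\<Sum>L'\<in>{L' \<in> \<L>. L' \<subset> L}. N L' h) = (\<Sum>L'\<in>{L' \<in> \<L>. L' \<subset> L}. N L' g)"
      by (intro sum.cong refl less(1) psubset_card_mono) auto
    ultimately show ?case
      unfolding split by (simp add: fin)
  qed
  have r1: "range (mul 1) = UNIV" by (auto simp: one_left intro: range_eqI)
  then have "UNIV \<in> \<L>" by (auto simp: \<L>_def)
  then have "N UNIV h = N UNIV g" by (rule eq)
  moreover have "N UNIV g > 0"
    unfolding N_def using r1 act_one by (auto simp: card_gt_0_iff)
  ultimately have "{x. range (mul x) = UNIV \<and> act g x = h} \<noteq> {}"
    unfolding N_def by (metis card.empty less_irrefl)
  then show ?thesis by auto
qed

text \<open>The lifted element \<open>x\<close> generates the ring as a right ideal, so it has a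
  right inverse, and in a finite ring this makes it a unit.\<close>

lemma right_cyclic_eq_imp_unit:
  fixes g h :: "'a::{ring_1, finite} vec"
  assumes "right_cyclic g = right_cyclic h"
  obtains u where "u \<in> ring_units" "h = smult_right g u"
proof -
  have "\<exists>x. range ((*) x) = UNIV \<and> smult_right g x = h"
  proof (rule generator_lifting)
    fix v :: "'a vec" and a b c :: 'a
    assume "smult_right v a = smult_right v b"
    then show "smult_right v (a + c) = smult_right v (b + c)"
      by (auto simp: vec_eq_iff distrib_left)
  qed (use assms in \<open>auto simp: right_cyclic_def mult.assoc distrib_left vec_eq_iff\<close>)
  then obtain x where x: "range ((*) x) = UNIV" "smult_right g x = h" by auto
  obtain y where "x * y = 1" using x(1) by (metis UNIV_I imageE)
  then show thesis using that x(2) ring_unitsI by metis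
qed

text \<open>The lifting argument is applied to the opposite multiplication, for which left scalars
  act from the right.\<close>

lemma left_cyclic_eq_imp_unit:
  fixes g h :: "'a::{ring_1, finite} vec"
  assumes "left_cyclic g = left_cyclic h"
  obtains u where "u \<in> ring_units" "h = u \<cdot>\<^sub>v g"
proof -
  have "\<exists>x. range (\<lambda>a. a * x) = UNIV \<and> x \<cdot>\<^sub>v g = h"
  proof (rule generator_lifting[of "\<lambda>x a. a * x" "\<lambda>v a. a \<cdot>\<^sub>v v"])
    fix v :: "'a vec" and a b c :: 'a
    assume "a \<cdot>\<^sub>v v = b \<cdot>\<^sub>v v"
    then show "(a + c) \<cdot>\<^sub>v v = (b + c) \<cdot>\<^sub>v v"
      by (auto simp: vec_eq_iff distrib_right)
  qed (use assms in \<open>auto simp: left_cyclic_def mult.assoc distrib_right vec_eq_iff\<close>)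
  then obtain x where x: "range (\<lambda>a. a * x) = UNIV" "x \<cdot>\<^sub>v g = h" by auto
  obtain y where "y * x = 1" using x(1) by (metis UNIV_I imageE)
  then show thesis using that x(2) ring_unitsI by metis
qed

section \<open>Unit orbits inside a cyclic module\<close>

lemma right_cyclic_smult_unit:
  assumes "u \<in> ring_units"
  shows "right_cyclic (smult_right g u) = right_cyclic g"
proof -
  obtain v where v: "u * v = 1" using assms by (rule ring_unitsE)
  have 1: "smult_right (smult_right g u) a = smult_right g (u * a)" for a
    by (auto simp: vec_eq_iff mult.assoc)
  have 2: "smult_right g a = smult_right (smult_right g u) (v * a)" for a
    unfolding 1 by (simp add: mult.assoc[symmetric] v)
  show ?thesis
    unfolding right_cyclic_def
  proof (intro equalityI image_subsetI)
    show "smult_right (smult_right g u) a \<in> range (smult_right g)" for a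
      unfolding 1 by (rule rangeI)
    show "smult_right g a \<in> range (smult_right (smult_right g u))" for a
      by (subst 2) (rule rangeI)
  qed
qed

lemma left_cyclic_smult_unit:
  fixes g :: "'a::ring_1 vec"
  assumes "u \<in> ring_units"
  shows "left_cyclic (u \<cdot>\<^sub>v g) = left_cyclic g"
proof -
  obtain v where v: "v * u = 1" using assms by (rule ring_unitsE)
  have 1: "a \<cdot>\<^sub>v (u \<cdot>\<^sub>v g) = (a * u) \<cdot>\<^sub>v g" for a
    by (auto simp: vec_eq_iff mult.assoc)
  have 2: "a \<cdot>\<^sub>v g = (a * v) \<cdot>\<^sub>v (u \<cdot>\<^sub>v g)" for a
    unfolding 1 by (simp add: mult.assoc v)
  show ?thesis
    unfolding left_cyclic_def
  proof (intro equalityI image_subsetI)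
    show "a \<cdot>\<^sub>v (u \<cdot>\<^sub>v g) \<in> range (\<lambda>a. a \<cdot>\<^sub>v g)" for a
      unfolding 1 by (rule rangeI)
    show "a \<cdot>\<^sub>v g \<in> range (\<lambda>a. a \<cdot>\<^sub>v (u \<cdot>\<^sub>v g))" for a
      by (subst 2) (rule rangeI)
  qed
qed

text \<open>An orbit-stabiliser count: \<open>g\<close> is a unit multiple of \<open>h\<close>, so
  \<open>u \<mapsto> hu\<close> maps the units onto the unit orbit of \<open>g\<close>, and all its
  fibres have the same size.\<close>

lemma card_unit_fibre:
  fixes g h :: "'a::{ring_1, finite} vec"
  assumes "right_cyclic h = right_cyclic g"
  shows "card {u \<in> ring_units. smult_right h u = g} * card {smult_right g u | u. u \<in> ring_units}
    = card (ring_units :: 'a set)"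
proof -
  let ?U = "ring_units :: 'a set"
  obtain u0 where u0: "u0 \<in> ?U" "g = smult_right h u0"
    using assms by (rule right_cyclic_eq_imp_unit)
  have g_smult: "smult_right g v = smult_right h (u0 * v)" for v
    by (auto simp: u0 vec_eq_iff mult.assoc)
  \<comment> \<open>Left multiplication by \<open>u0\<close> permutes the units, so
    \<open>h u0\<close> and \<open>h\<close> have the same orbit.\<close>
  have orbit: "{smult_right g u | u. u \<in> ?U} = smult_right h ` ?U"
    unfolding g_smult
    by (subst (2) bij_betw_imp_surj_on[OF bij_betw_mult_left_ring_units[OF u0(1)], symmetric]) auto
  have fibre: "card {u \<in> ?U. smult_right h u = g'} = card {u \<in> ?U. smult_right h u = g}"
    if g': "g' \<in> smult_right h ` ?U" for g'
  proof -
    obtain v where v: "v \<in> ?U" "g' = smult_right g v"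
      using g' orbit by auto
    obtain v' where v': "v' \<in> ?U" "v * v' = 1" "v' * v = 1"
      using v(1) by (rule ring_unitsE)
    have g'v: "smult_right g' v' = g"
      using v' by (auto simp: v(2) vec_eq_iff mult.assoc)
    have assoc: "smult_right h (u * w) = smult_right (smult_right h u) w" for u w
      by (auto simp: vec_eq_iff mult.assoc)
    show ?thesis
      \<comment> \<open>With \<open>g' = g v\<close>, right multiplication by the inverse
        \<open>v'\<close> carries the fibre over \<open>g'\<close> to the fibre over
        \<open>g\<close>, and multiplication by \<open>v\<close> carries it back.\<close>
      by (rule bij_betw_same_card[of "\<lambda>u. u * v'"],
          rule bij_betw_byWitness[of _ "\<lambda>u. u * v"])
        (use v v' g'v mult_in_ring_units in \<open>auto simp: assoc mult.assoc\<close>)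
  qed
  have "card ?U = (\<Sum>g'\<in>smult_right h ` ?U. card {u \<in> ?U. smult_right h u = g'})"
    using sum.image_gen[of ?U "\<lambda>_. 1::nat" "smult_right h"] by simp
  also have "\<dots> = (\<Sum>g'\<in>smult_right h ` ?U. card {u \<in> ?U. smult_right h u = g})"
    using fibre by (intro sum.cong) auto
  finally show ?thesis by (simp add: orbit mult.commute)
qed

section \<open>Generating characters\<close>

lemma additive_character_simps:
  assumes "additive_character \<chi>"
  shows "\<chi> (x + y) = \<chi> x * \<chi> y" "\<chi> (x - y) = \<chi> x * \<chi> (- y)" "\<chi> 0 = 1"
  using assms additive_character_0[OF assms]
  by (simp_all add: additive_character_def flip: add_uminus_conv_diff)

lemma additive_character_eq_iff:
  assumes "additive_character \<chi>"
  shows "\<chi> x = \<chi> y \<longleftrightarrow> \<chi> (x - y) = 1"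
proof -
  have "\<chi> x = \<chi> (x - y) * \<chi> y" "\<chi> y \<noteq> 0"
    using additive_character_simps(1)[OF assms, of "x - y" y] assms
    by (auto simp: additive_character_def)
  then show ?thesis by auto
qed

text \<open>The left ideal \<open>Ra\<close> lies in the kernel of \<open>\<chi>\<close>, hence is
  zero, and it contains \<open>a\<close>.\<close>

lemma generating_character_left:
  assumes "generating_character \<chi>" "\<And>y. \<chi> (y * a) = 1"
  shows "a = 0"
proof -
  have "left_ideal (range (\<lambda>y. y * a))"
    unfolding left_ideal_def
    by (auto simp: mult.assoc[symmetric] distrib_right[symmetric] intro: range_eqI[of _ _ 0])
  then have "range (\<lambda>y. y * a) = {0}"
    using assms unfolding generating_character_def by blast
  then have "1 * a \<in> {0}" by blast
  then show ?thesis by simp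
qed

lemma sum_character_left:
  fixes \<chi> :: "'a::{ring_1, finite} \<Rightarrow> complex"
  assumes "generating_character \<chi>"
  shows "(\<Sum>y\<in>UNIV. \<chi> (y * a)) = (if a = 0 then of_nat (card (UNIV :: 'a set)) else 0)"
proof (cases "a = 0")
  case False
  have ac: "additive_character \<chi>" using assms by (simp add: generating_character_def)
  obtain b where b: "\<chi> (b * a) \<noteq> 1"
    using generating_character_left[OF assms] False by blast
  have "(\<Sum>y\<in>UNIV. \<chi> (y * a)) = 0"
    by (rule sum_eq_0_if_scaled[of "\<lambda>y. b + y" _ _ "\<chi> (b * a)"])
      (auto simp: b distrib_right additive_character_simps[OF ac] bij_betw_def
        intro: range_eqI[of _ _ "x - b" for x])
  then show ?thesis using False by simp
next
  case True
  then show ?thesis using assms by (simp add: generating_character_def additive_character_0)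
qed

text \<open>The definition speaks of left ideals only. The version for right ideals follows by
  summing \<open>\<chi> (c * y)\<close> over all \<open>c\<close> and \<open>y\<close> in both
  orders: each \<open>c\<close> in \<open>?K\<close> contributes \<open>|R|\<close>, while in the
  other order only \<open>y = 0\<close> does. So \<open>?K\<close> has one element.\<close>

lemma generating_character_right:
  fixes \<chi> :: "'a::{ring_1, finite} \<Rightarrow> complex"
  assumes "generating_character \<chi>" "\<And>y. \<chi> (a * y) = 1"
  shows "a = 0"
proof (rule ccontr)
  assume "a \<noteq> 0"
  let ?q = "of_nat (card (UNIV :: 'a set)) :: complex"
  let ?K = "{a. \<forall>y. \<chi> (a * y) = 1}"
  have ac: "additive_character \<chi>" using assms by (simp add: generating_character_def)
  have row: "(\<Sum>y\<in>UNIV. \<chi> (c * y)) = (if c \<in> ?K then ?q else 0)" for c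
  proof (cases "c \<in> ?K")
    case False
    then obtain b where b: "\<chi> (c * b) \<noteq> 1" by auto
    have "(\<Sum>y\<in>UNIV. \<chi> (c * y)) = 0"
      by (rule sum_eq_0_if_scaled[of "\<lambda>y. b + y" _ _ "\<chi> (c * b)"])
        (auto simp: b distrib_left additive_character_simps[OF ac] bij_betw_def
          intro: range_eqI[of _ _ "x - b" for x])
    then show ?thesis using False by simp
  qed simp
  have "?q * of_nat (card ?K) = (\<Sum>c\<in>UNIV. \<Sum>y\<in>UNIV. \<chi> (c * y))"
    unfolding row by (simp add: sum.If_cases)
  also have "\<dots> = (\<Sum>y\<in>UNIV. \<Sum>c\<in>UNIV. \<chi> (c * y))"
    by (rule sum.swap)
  also have "\<dots> = ?q * 1"
    unfolding sum_character_left[OF assms(1)] by simp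
  finally have "of_nat (card ?K) = (of_nat 1 :: complex)"
    by (simp add: card_gt_0_iff)
  then have "card ?K = 1" by (simp only: of_nat_eq_iff)
  moreover have "card {0, a} \<le> card ?K"
    using assms(2) by (intro card_mono) (auto simp: additive_character_simps[OF ac])
  ultimately show False using \<open>a \<noteq> 0\<close> by simp
qed

lemma generating_character_eqD:
  fixes \<chi> :: "'a::{ring_1, finite} \<Rightarrow> complex"
  assumes "generating_character \<chi>"
  shows "(\<And>y. \<chi> (a * y) = \<chi> (b * y)) \<Longrightarrow> a = b" "(\<And>y. \<chi> (y * a) = \<chi> (y * b)) \<Longrightarrow> a = b"
proof -
  have ac: "additive_character \<chi>" using assms by (simp add: generating_character_def)
  show "a = b" if "\<And>y. \<chi> (a * y) = \<chi> (b * y)"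
    using generating_character_right[OF assms, of "a - b"] that
    by (simp add: left_diff_distrib additive_character_eq_iff[OF ac])
  show "a = b" if "\<And>y. \<chi> (y * a) = \<chi> (y * b)"
    using generating_character_left[OF assms, of "a - b"] that
    by (simp add: right_diff_distrib additive_character_eq_iff[OF ac])
qed

text \<open>If no such \<open>b\<close> existed, \<open>x \<mapsto> \<chi> (x * a)\<close> would be orthogonal to all the characters
  \<open>x \<mapsto> \<chi> (b * x)\<close>; but their sum over \<open>b\<close> is supported at \<open>x = 0\<close>.\<close>

lemma nakayama:
  fixes \<chi> :: "'a::{ring_1, finite} \<Rightarrow> complex"
  assumes "generating_character \<chi>"
  shows "\<exists>b. \<forall>x. \<chi> (x * a) = \<chi> (b * x)"
proof (rule ccontr)
  assume no: "\<nexists>b. \<forall>x. \<chi> (x * a) = \<chi> (b * x)"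
  have ac: "additive_character \<chi>" using assms by (simp add: generating_character_def)
  have "(\<Sum>x\<in>UNIV. \<chi> (x * a) * \<chi> (b * (- x))) = 0" for b
  proof -
    obtain z where "\<chi> (z * a) \<noteq> \<chi> (b * z)" using no by blast
    then have z: "\<chi> (z * a) * \<chi> (- (b * z)) \<noteq> 1"
      by (simp add: additive_character_eq_iff[OF ac] additive_character_simps[OF ac])
    show ?thesis
      by (rule sum_eq_0_if_scaled[of "\<lambda>x. z + x" _ _ "\<chi> (z * a) * \<chi> (- (b * z))"])
        (use z in \<open>auto simp: distrib_left distrib_right additive_character_simps[OF ac] bij_betw_def
          right_diff_distrib intro: range_eqI[of _ _ "x - z" for x]\<close>)
  qed
  then have "0 = (\<Sum>b\<in>UNIV. \<Sum>x\<in>UNIV. \<chi> (x * a) * \<chi> (b * (- x)))" by simp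
  also have "\<dots> = (\<Sum>x\<in>UNIV. \<Sum>b\<in>UNIV. \<chi> (x * a) * \<chi> (b * (- x)))" by (rule sum.swap)
  also have "\<dots> = (\<Sum>x\<in>UNIV. \<chi> (x * a) * (if x = 0 then of_nat (card (UNIV :: 'a set)) else 0))"
    unfolding sum_distrib_left[symmetric] sum_character_left[OF assms] by simp
  also have "\<dots> = of_nat (card (UNIV :: 'a set))"
    by (simp add: if_distrib[of "(*) _"] additive_character_simps[OF ac] cong: if_cong)
  finally show False by simp
qed

text \<open>The map \<open>\<phi>\<close> with \<open>\<chi> (x * a) = \<chi> (\<phi> a * x)\<close>
  is multiplicative, fixes 1 and is injective on the units. Hence it permutes the units, and
  reindexing the sum along it moves them to the other side of \<open>x\<close>.\<close>

lemma sum_units_left_eq_right: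
  fixes \<chi> :: "'a::{ring_1, finite} \<Rightarrow> complex"
  assumes "generating_character \<chi>"
  shows "(\<Sum>u\<in>ring_units. \<chi> (u * x)) = (\<Sum>u\<in>ring_units. \<chi> (x * u))"
proof -
  let ?U = "ring_units :: 'a set"
  obtain \<phi> where \<phi>: "\<And>a x. \<chi> (x * a) = \<chi> (\<phi> a * x)"
    using nakayama[OF assms] by metis
  have \<phi>_mult: "\<phi> (a * b) = \<phi> a * \<phi> b" for a b
    by (rule generating_character_eqD(1)[OF assms]) (simp add: mult.assoc flip: \<phi>)
  have \<phi>_1: "\<phi> 1 = 1"
    by (rule generating_character_eqD(1)[OF assms]) (simp flip: \<phi>)
  have inj: "inj_on \<phi> ?U"
  proof (rule inj_onI, rule generating_character_eqD(2)[OF assms])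
    fix a b y assume "\<phi> a = \<phi> b"
    then show "\<chi> (y * a) = \<chi> (y * b)"
      using \<phi>[of y a] \<phi>[of y b] by argo
  qed
  have units: "\<phi> ` ?U \<subseteq> ?U"
  proof (rule image_subsetI)
    fix u assume "u \<in> ?U"
    then obtain v where "u * v = 1" by (rule ring_unitsE)
    then have "\<phi> u * \<phi> v = 1" using \<phi>_1 by (simp flip: \<phi>_mult)
    then show "\<phi> u \<in> ?U" by (rule ring_unitsI)
  qed
  have "\<phi> ` ?U = ?U"
    using endo_inj_surj[OF _ units inj] by simp
  then have "(\<Sum>u\<in>?U. \<chi> (u * x)) = (\<Sum>u\<in>?U. \<chi> (\<phi> u * x))"
    using sum.reindex[OF inj, of "\<lambda>u. \<chi> (u * x)"] by simp
  then show ?thesis by (simp flip: \<phi>)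
qed

text \<open>With the units on the right, the arguments of \<open>\<chi>\<close> are left linear in
  \<open>x\<close>, as the character sums over a left code require.\<close>

lemma hom_weight_right:
  fixes \<chi> :: "'a::{ring_1, finite} \<Rightarrow> complex"
  assumes "generating_character \<chi>"
  shows "complex_of_real (hom_weight \<chi> x) =
    1 - (\<Sum>u\<in>ring_units. \<chi> (x * u)) / of_nat (card (ring_units :: 'a set))"
  using of_real_hom_weight[of \<chi> x] assms
  by (simp add: generating_character_def sum_units_left_eq_right)

lemma hom_weight_unit:
  fixes \<chi> :: "'a::{ring_1, finite} \<Rightarrow> complex"
  assumes "v \<in> ring_units"
  shows "hom_weight \<chi> (v * x) = hom_weight \<chi> x"
  using sum.reindex_bij_betw[OF bij_betw_mult_right_ring_units[OF assms], of "\<lambda>u. \<chi> (u * x)"]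
  by (simp add: hom_weight_def mult.assoc)

lemma hom_weight_0:
  fixes \<chi> :: "'a::{ring_1, finite} \<Rightarrow> complex"
  assumes "additive_character \<chi>"
  shows "hom_weight \<chi> 0 = 0"
  using card_ring_units_pos[where 'a='a] by (auto simp: hom_weight_def additive_character_simps[OF assms])

lemma cmod_additive_character:
  fixes \<chi> :: "'a::{ring_1, finite} \<Rightarrow> complex"
  assumes "additive_character \<chi>"
  shows "cmod (\<chi> x) = 1"
proof -
  have "\<chi> x * cnj (\<chi> x) = 1"
    using additive_character_simps(1)[OF assms, of x "- x"]
    by (simp add: additive_character_uminus[OF assms] additive_character_simps(3)[OF assms])
  then have "cmod (\<chi> x) ^ 2 = 1"
    by (metis complex_norm_square of_real_1 of_real_eq_iff)
  then show ?thesis by (simp add: power2_eq_1_iff) (metis norm_ge_zero neg_0_le_iff_le not_one_le_zero)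
qed

text \<open>An average of complex numbers of modulus 1 has real part at most 1.\<close>

lemma hom_weight_nonneg:
  fixes \<chi> :: "'a::{ring_1, finite} \<Rightarrow> complex"
  assumes "additive_character \<chi>"
  shows "hom_weight \<chi> x \<ge> 0"
proof -
  let ?U = "ring_units :: 'a set"
  have "Re (\<Sum>u\<in>?U. \<chi> (u * x)) \<le> (\<Sum>u\<in>?U. cmod (\<chi> (u * x)))"
    using complex_Re_le_cmod norm_sum order_trans by blast
  then have "Re (\<Sum>u\<in>?U. \<chi> (u * x)) / real (card ?U) \<le> 1"
    using card_ring_units_pos[where 'a='a] by (simp add: cmod_additive_character[OF assms])
  moreover have "Re (1 / of_nat (card ?U) * (\<Sum>u\<in>?U. \<chi> (u * x))) =
      Re (\<Sum>u\<in>?U. \<chi> (u * x)) / real (card ?U)"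
    using Re_divide_of_nat[of "\<Sum>u\<in>?U. \<chi> (u * x)" "card ?U"] by simp
  ultimately show ?thesis by (simp add: hom_weight_def)
qed

section \<open>Character sums over codes\<close>

lemma finite_carrier_vec: "finite (carrier_vec n :: 'a::finite vec set)"
proof (rule finite_subset)
  show "carrier_vec n \<subseteq> (vec_of_list :: 'a list \<Rightarrow> _) ` {xs. set xs \<subseteq> UNIV \<and> length xs = n}"
  proof
    fix v :: "'a vec" assume "v \<in> carrier_vec n"
    then show "v \<in> vec_of_list ` {xs. set xs \<subseteq> UNIV \<and> length xs = n}"
      by (intro image_eqI[of _ _ "list_of_vec v"]) (auto simp: vec_list)
  qed
qed (intro finite_imageI finite_lists_length_eq finite_UNIV)

lemma scalar_prod_smult_right_distrib:
  assumes "dim_vec y = dim_vec x"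
  shows "x \<bullet> smult_right y a = (x \<bullet> y) * a"
  using assms by (simp add: scalar_prod_def sum_distrib_right mult.assoc)

lemma scalar_prod_faithful:
  fixes v :: "'a::ring_1 vec"
  assumes "v \<in> carrier_vec k"
  shows "(\<forall>x\<in>carrier_vec k. x \<bullet> v = 0) \<longleftrightarrow> v = 0\<^sub>v k"
proof
  assume *: "\<forall>x\<in>carrier_vec k. x \<bullet> v = 0"
  show "v = 0\<^sub>v k"
  proof (rule eq_vecI)
    fix i assume "i < dim_vec (0\<^sub>v k :: 'a vec)"
    then show "v $ i = 0\<^sub>v k $ i"
      using *[rule_format, of "unit_vec k i"] scalar_prod_left_unit[OF assms, of i] by simp
  qed (use assms in auto)
qed auto

lemma left_linear_codeD:
  assumes "left_linear_code n C"
  shows "C \<subseteq> carrier_vec n" "0\<^sub>v n \<in> C" "c \<in> C \<Longrightarrow> d \<in> C \<Longrightarrow> c + d \<in> C" "c \<in> C \<Longrightarrow> a \<cdot>\<^sub>v c \<in> C"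
  using assms by (auto simp: left_linear_code_def)

lemma left_linear_code_finite:
  fixes C :: "'a::{ring_1, finite} vec set"
  assumes "left_linear_code n C"
  shows "finite C"
  using left_linear_codeD(1)[OF assms] finite_carrier_vec finite_subset by blast

text \<open>If \<open>f c0\<close> is nonzero, \<open>\<chi>\<close> is nontrivial on the left ideal
  \<open>R (f c0)\<close>, so translating \<open>C\<close> by a suitable multiple of
  \<open>c0\<close> scales the sum by a factor other than 1.\<close>

lemma sum_character_functional:
  fixes \<chi> :: "'a::{ring_1, finite} \<Rightarrow> complex"
  assumes gen: "generating_character \<chi>" and C: "left_linear_code n C"
    and add: "\<And>c d. c \<in> C \<Longrightarrow> d \<in> C \<Longrightarrow> f (c + d) = f c + f d"
    and smult: "\<And>a c. c \<in> C \<Longrightarrow> f (a \<cdot>\<^sub>v c) = a * f c"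
  shows "(\<Sum>c\<in>C. \<chi> (f c)) = (if \<forall>c\<in>C. f c = 0 then of_nat (card C) else 0)"
proof (cases "\<forall>c\<in>C. f c = 0")
  case True
  then have "(\<Sum>c\<in>C. \<chi> (f c)) = (\<Sum>c\<in>C. 1)"
    using gen by (intro sum.cong) (auto simp: generating_character_def additive_character_0)
  with True show ?thesis by simp
next
  case False
  have ac: "additive_character \<chi>" using gen by (simp add: generating_character_def)
  note C' = left_linear_codeD[OF C]
  obtain c0 where c0: "c0 \<in> C" "f c0 \<noteq> 0" using False by auto
  then obtain a where a: "\<chi> (a * f c0) \<noteq> 1" using generating_character_left[OF gen] by blast
  define d where "d = a \<cdot>\<^sub>v c0"
  have d: "d \<in> C" "(-1) \<cdot>\<^sub>v d \<in> C" using C'(4) c0 by (auto simp: d_def)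
  \<comment> \<open>Translation by \<open>d\<close> is inverted by translation by
    \<open>(-1) \<cdot>\<^sub>v d\<close>, which lies in \<open>C\<close> because the code is closed
    under scalars.\<close>
  have cancel: "c + d + (-1) \<cdot>\<^sub>v d = c" "c + (-1) \<cdot>\<^sub>v d + d = c" if "c \<in> C" for c
  proof -
    have "c \<in> carrier_vec n" "d \<in> carrier_vec n" using that C'(1) d(1) by auto
    then show "c + d + (-1) \<cdot>\<^sub>v d = c" "c + (-1) \<cdot>\<^sub>v d + d = c" by (auto simp: vec_eq_iff)
  qed
  have "(\<Sum>c\<in>C. \<chi> (f c)) = 0"
  proof (rule sum_eq_0_if_scaled[of "\<lambda>c. c + d" _ _ "\<chi> (a * f c0)"])
    show "bij_betw (\<lambda>c. c + d) C C"
      by (rule bij_betw_byWitness[of _ "\<lambda>c. c + (-1) \<cdot>\<^sub>v d"]) (use cancel d C'(3) in auto)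
    show "\<chi> (f (c + d)) = \<chi> (a * f c0) * \<chi> (f c)" if "c \<in> C" for c
      using that d(1) c0(1) by (simp add: add) (simp add: d_def smult additive_character_simps[OF ac])
  qed (rule a)
  with False show ?thesis by auto
qed

text \<open>Here the second factor of the product varies, so nontriviality of \<open>\<chi>\<close>
  is needed on a right ideal: the one generated by a nonzero entry of \<open>v\<close>.\<close>

lemma sum_character_vec:
  fixes \<chi> :: "'a::{ring_1, finite} \<Rightarrow> complex"
  assumes gen: "generating_character \<chi>" and v: "v \<in> carrier_vec n"
  shows "(\<Sum>y\<in>carrier_vec n. \<chi> (v \<bullet> y)) =
    (if v = 0\<^sub>v n then of_nat (card (carrier_vec n :: 'a vec set)) else 0)"
proof (cases "v = 0\<^sub>v n")
  case True
  then show ?thesis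
    using gen by (simp add: generating_character_def additive_character_0)
next
  case False
  have ac: "additive_character \<chi>" using gen by (simp add: generating_character_def)
  obtain i where i: "i < n" "v $ i \<noteq> 0" using False v by (auto simp: vec_eq_iff)
  then obtain a where a: "\<chi> (v $ i * a) \<noteq> 1" using generating_character_right[OF gen] by blast
  define d where "d = smult_right (unit_vec n i) a"
  have d: "d \<in> carrier_vec n" "v \<bullet> d = v $ i * a"
    using v i by (auto simp: d_def scalar_prod_smult_right_distrib)
  have "(\<Sum>y\<in>carrier_vec n. \<chi> (v \<bullet> y)) = 0"
  proof (rule sum_eq_0_if_scaled[of "\<lambda>y. y + d" _ _ "\<chi> (v $ i * a)"])
    show "bij_betw (\<lambda>y. y + d) (carrier_vec n) (carrier_vec n)"
      by (rule bij_betw_byWitness[of _ "\<lambda>y. y - d"]) (use d(1) in \<open>auto simp: vec_eq_iff\<close>)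
    show "\<chi> (v \<bullet> (y + d)) = \<chi> (v $ i * a) * \<chi> (v \<bullet> y)" if "y \<in> carrier_vec n" for y
      using that v d by (simp add: scalar_prod_add_distrib[of _ n] additive_character_simps[OF ac])
  qed (rule a)
  with False show ?thesis by simp
qed

section \<open>Right codes generated by the columns of a matrix\<close>

lemma right_linear_code_range:
  fixes M :: "'a::ring_1 mat"
  assumes M: "M \<in> carrier_mat m n"
  shows "right_linear_code m {M *\<^sub>v y | y. y \<in> carrier_vec n}"
  unfolding right_linear_code_def
proof (intro conjI ballI allI)
  show "0\<^sub>v m \<in> {M *\<^sub>v y | y. y \<in> carrier_vec n}"
    using M by (auto intro!: exI[of _ "0\<^sub>v n"] eq_vecI)
next
  fix x y assume "x \<in> {M *\<^sub>v y | y. y \<in> carrier_vec n}" "y \<in> {M *\<^sub>v y | y. y \<in> carrier_vec n}"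
  then obtain a b where "x = M *\<^sub>v a" "y = M *\<^sub>v b" "a \<in> carrier_vec n" "b \<in> carrier_vec n" by auto
  then show "x + y \<in> {M *\<^sub>v y | y. y \<in> carrier_vec n}"
    using mult_add_distrib_mat_vec[OF M] by (auto intro!: exI[of _ "a + b"])
next
  fix x a assume "x \<in> {M *\<^sub>v y | y. y \<in> carrier_vec n}"
  then obtain y where "x = M *\<^sub>v y" "y \<in> carrier_vec n" by auto
  then show "smult_right x a \<in> {M *\<^sub>v y | y. y \<in> carrier_vec n}"
    using M by (auto intro!: exI[of _ "smult_right y a"] eq_vecI simp: scalar_prod_smult_right_distrib)
qed (use M in auto)

lemma right_column_code_eq_range:
  fixes M :: "'a::ring_1 mat"
  assumes M: "M \<in> carrier_mat m n"
  shows "right_column_code M = {M *\<^sub>v y | y. y \<in> carrier_vec n}"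
  unfolding right_column_code_def
proof (rule hull_unique)
  show "set (cols M) \<subseteq> {M *\<^sub>v y | y. y \<in> carrier_vec n}"
  proof
    fix c assume "c \<in> set (cols M)"
    then obtain j where "j < n" "c = col M j" using M by (auto simp: cols_def)
    then show "c \<in> {M *\<^sub>v y | y. y \<in> carrier_vec n}"
      using M by (auto intro!: exI[of _ "unit_vec n j"] eq_vecI)
  qed
  show "right_linear_code (dim_row M) {M *\<^sub>v y | y. y \<in> carrier_vec n}"
    using M right_linear_code_range[OF M] by simp
  fix T assume cols: "set (cols M) \<subseteq> T" and "right_linear_code (dim_row M) T"
  then have zero: "0\<^sub>v m \<in> T" and add: "\<And>x y. x \<in> T \<Longrightarrow> y \<in> T \<Longrightarrow> x + y \<in> T"
    and smult: "\<And>x a. x \<in> T \<Longrightarrow> smult_right x a \<in> T"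
    using M by (auto simp: right_linear_code_def)
  show "{M *\<^sub>v y | y. y \<in> carrier_vec n} \<subseteq> T"
  proof
    fix z assume "z \<in> {M *\<^sub>v y | y. y \<in> carrier_vec n}"
    then obtain y where y: "z = M *\<^sub>v y" "y \<in> carrier_vec n" by auto
    \<comment> \<open>The word is built up one column at a time: the partial combination of the
      first \<open>l\<close> columns stays in every right linear code containing the
      columns.\<close>
    have "vec m (\<lambda>i. \<Sum>j<l. M $$ (i, j) * y $ j) \<in> T" if "l \<le> n" for l
      using that
    proof (induction l)
      case 0
      have "vec m (\<lambda>i. \<Sum>j<0. M $$ (i, j) * y $ j) = 0\<^sub>v m" by (intro eq_vecI) auto
      then show ?case using zero by simp
    next
      case (Suc l)
      have "vec m (\<lambda>i. \<Sum>j<Suc l. M $$ (i, j) * y $ j) =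
          vec m (\<lambda>i. \<Sum>j<l. M $$ (i, j) * y $ j) + smult_right (col M l) (y $ l)"
        using M Suc.prems by (intro eq_vecI) auto
      moreover have "col M l \<in> T" using cols M Suc.prems by (auto simp: cols_def)
      ultimately show ?case using Suc add smult by simp
    qed
    from this[of n] show "z \<in> T"
    proof (simp, elim back_subst[of "\<lambda>v. v \<in> T"])
      show "vec m (\<lambda>i. \<Sum>j<n. M $$ (i, j) * y $ j) = z"
        using M y(2) by (intro eq_vecI) (auto simp: y(1) scalar_prod_def lessThan_atLeast0)
    qed
  qed
qed

text \<open>For a modular code generated by \<open>G\<close>, this is \<open>\<alpha>(gR) / |gR\<^sup>\<times>|\<close> at the point \<open>g = - G y\<close>,
  expressed without reference to \<open>G\<close>.\<close>

definition unit_match :: "nat \<Rightarrow> 'a::{ring_1, finite} vec set \<Rightarrow> 'a vec \<Rightarrow> real" where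
  "unit_match n C y = (\<Sum>j<n. real (card {u \<in> ring_units. \<forall>c\<in>C. c \<bullet> y + c $ j * u = 0}))
    / real (card (ring_units :: 'a set))"

text \<open>Expanding the weight turns the sum into character sums of the left linear functionals
  \<open>c \<mapsto> c \<bullet> y\<close> and \<open>c \<mapsto> c \<bullet> y + c $ j * u\<close>.
  Each equals \<open>|C|\<close> or 0 according to whether its functional vanishes on
  \<open>C\<close>, so only a count of pairs \<open>(j, u)\<close> remains.\<close>

lemma weight_transform:
  fixes \<chi> :: "'a::{ring_1, finite} \<Rightarrow> complex"
  assumes gen: "generating_character \<chi>" and C: "left_linear_code n C" and y: "y \<in> carrier_vec n"
  shows "(\<Sum>c\<in>C. of_real (word_weight \<chi> c) * \<chi> (c \<bullet> y)) =
    of_real (real (card C) * ((if \<forall>c\<in>C. c \<bullet> y = 0 then real n else 0) - unit_match n C y))"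
proof -
  let ?U = "ring_units :: 'a set"
  let ?Z = "\<lambda>j u. \<forall>c\<in>C. c \<bullet> y + c $ j * u = 0"
  let ?P = "if \<forall>c\<in>C. c \<bullet> y = 0 then of_nat (card C) else 0 :: complex"
  note C' = left_linear_codeD[OF C]
  have ac: "additive_character \<chi>" using gen by (simp add: generating_character_def)
  have summand: "of_real (word_weight \<chi> c) * \<chi> (c \<bullet> y) =
      (\<Sum>j<n. \<chi> (c \<bullet> y) - (\<Sum>u\<in>?U. \<chi> (c \<bullet> y + c $ j * u)) / of_nat (card ?U))" if "c \<in> C" for c
  proof -
    have "dim_vec c = n" using that C'(1) by auto
    then show ?thesis
      by (simp add: word_weight_def hom_weight_right[OF gen] sum_distrib_right sum_distrib_left
          left_diff_distrib right_diff_distrib additive_character_simps(1)[OF ac] mult.commute)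
  qed
  have add: "(c + d) \<bullet> y = c \<bullet> y + d \<bullet> y" if "c \<in> C" "d \<in> C" for c d
    using that C'(1) y by (intro add_scalar_prod_distrib[of _ n]) auto
  have smult: "(a \<cdot>\<^sub>v c) \<bullet> y = a * (c \<bullet> y)" if "c \<in> C" for a c
    using that C'(1) y by (intro smult_scalar_prod_distrib[of _ n]) auto
  have 1: "(\<Sum>c\<in>C. \<chi> (c \<bullet> y)) = ?P"
    by (rule sum_character_functional[OF gen C]) (use add smult in auto)
  have 2: "(\<Sum>c\<in>C. \<chi> (c \<bullet> y + c $ j * u)) = (if ?Z j u then of_nat (card C) else 0)"
    if j: "j < n" for j u
  proof (rule sum_character_functional[OF gen C])
    fix c d assume cd: "c \<in> C" "d \<in> C"
    then have "dim_vec c = n" "dim_vec d = n" using C'(1) by auto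
    then show "(c + d) \<bullet> y + (c + d) $ j * u = c \<bullet> y + c $ j * u + (d \<bullet> y + d $ j * u)"
      using j by (simp add: add[OF cd] distrib_right)
  next
    fix a c assume c: "c \<in> C"
    then have "dim_vec c = n" using C'(1) by auto
    then show "(a \<cdot>\<^sub>v c) \<bullet> y + (a \<cdot>\<^sub>v c) $ j * u = a * (c \<bullet> y + c $ j * u)"
      using j by (simp add: smult[OF c] distrib_left mult.assoc)
  qed
  have "(\<Sum>c\<in>C. of_real (word_weight \<chi> c) * \<chi> (c \<bullet> y)) =
      (\<Sum>c\<in>C. \<Sum>j<n. \<chi> (c \<bullet> y) - (\<Sum>u\<in>?U. \<chi> (c \<bullet> y + c $ j * u)) / of_nat (card ?U))"
    by (rule sum.cong) (use summand in auto)
  also have "\<dots> = (\<Sum>j<n. \<Sum>c\<in>C. \<chi> (c \<bullet> y) - (\<Sum>u\<in>?U. \<chi> (c \<bullet> y + c $ j * u)) / of_nat (card ?U))"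
    by (rule sum.swap)
  also have "\<dots> = (\<Sum>j<n. ?P - (\<Sum>u\<in>?U. \<Sum>c\<in>C. \<chi> (c \<bullet> y + c $ j * u)) / of_nat (card ?U))"
    by (simp add: sum_subtractf 1 sum_divide_distrib[symmetric] sum.swap[of _ C])
  also have "\<dots> = (\<Sum>j<n. ?P - of_nat (card {u \<in> ?U. ?Z j u}) * of_nat (card C) / of_nat (card ?U))"
    by (intro sum.cong refl) (simp add: 2 sum.If_cases Int_def)
  also have "\<dots> = of_real (real (card C) * ((if \<forall>c\<in>C. c \<bullet> y = 0 then real n else 0) - unit_match n C y))"
    by (simp add: sum_subtractf unit_match_def right_diff_distrib sum_divide_distrib sum_distrib_left mult.commute)
  finally show ?thesis .
qed

text \<open>On a word \<open>xG\<close> the functional behind \<open>unit_match\<close> is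
  \<open>x \<bullet> (Gy + g u)\<close>, with \<open>g\<close> the column \<open>j\<close> of
  \<open>G\<close>. It vanishes for all \<open>x\<close> exactly when \<open>g u = - Gy\<close>,
  which ties the count to the multiplicity of the point generated by \<open>- Gy\<close>.\<close>

lemma unit_match_modular:
  fixes C :: "'a::{ring_1, finite} vec set"
  assumes mod: "left_modular_code n C r"
  shows "y \<in> carrier_vec n \<Longrightarrow> \<exists>c\<in>C. c \<bullet> y \<noteq> 0 \<Longrightarrow> unit_match n C y = 0 \<or> unit_match n C y = r"
    and "\<forall>c\<in>C. c \<bullet> y = 0 \<Longrightarrow> unit_match n C y = 0"
    and "j < n \<Longrightarrow> unit_match n C (unit_vec n j) = r"
    and "n > 0 \<Longrightarrow> r > 0"
proof -
  let ?U = "ring_units :: 'a set"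
  have C: "left_linear_code n C" and nz: "\<And>j. j < n \<Longrightarrow> \<exists>c\<in>C. c $ j \<noteq> 0"
    using mod by (auto simp: left_modular_code_def no_zero_coordinate_def)
  note C' = left_linear_codeD[OF C]
  show "unit_match n C y = 0" if perp: "\<forall>c\<in>C. c \<bullet> y = 0"
  proof -
    \<comment> \<open>A match at an orthogonal \<open>y\<close> would need
      \<open>c $ j * u = 0\<close> for every word \<open>c\<close>, but some \<open>c $ j\<close> is
      nonzero and \<open>u\<close> is invertible.\<close>
    have empty: "{u \<in> ?U. \<forall>c\<in>C. c \<bullet> y + c $ j * u = 0} = {}" if j: "j < n" for j
    proof -
      obtain c where c: "c \<in> C" "c $ j \<noteq> 0" using nz[OF j] by auto
      have "c $ j * u \<noteq> 0" if u: "u \<in> ?U" for u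
      proof
        obtain v where "u * v = 1" using u by (rule ring_unitsE)
        moreover assume "c $ j * u = 0"
        ultimately show False using c(2) by (metis mult.assoc mult_1_right mult_zero_left)
      qed
      then show ?thesis using perp c(1) by auto
    qed
    have "(\<Sum>j<n. real (card {u \<in> ?U. \<forall>c\<in>C. c \<bullet> y + c $ j * u = 0})) = 0"
    proof (rule sum.neutral, rule ballI)
      fix j assume "j \<in> {..<n}"
      then have "j < n" by simp
      then show "real (card {u \<in> ?U. \<forall>c\<in>C. c \<bullet> y + c $ j * u = 0}) = 0"
        by (simp only: empty card.empty of_nat_0)
    qed
    then show ?thesis by (simp add: unit_match_def)
  qed
  obtain k G where G: "G \<in> carrier_mat k n" and CG: "C = {vec_mult_mat x G | x. x \<in> carrier_vec k}"
    and pts: "\<And>g. g \<in> carrier_vec k \<Longrightarrow> g \<noteq> 0\<^sub>v k \<Longrightarrow>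
      card {j. j < n \<and> right_cyclic (col G j) = right_cyclic g} = 0 \<or>
      real (card {j. j < n \<and> right_cyclic (col G j) = right_cyclic g}) =
        r * real (card {smult_right g u | u. u \<in> ?U})"
    using mod unfolding left_modular_code_def Let_def by blast
  have Gy: "vec_mult_mat x G \<bullet> y = x \<bullet> (G *\<^sub>v y)" if "x \<in> carrier_vec k" "y \<in> carrier_vec n" for x y
    using assoc_scalar_prod[OF that(1) G that(2)] G by (simp add: vec_mult_mat_def mult_mat_vec_def)
  have orbit_pos: "card {smult_right g u | u. u \<in> ?U} > 0" for g :: "'a vec"
    using one_in_ring_units[where 'a='a] by (force simp: card_gt_0_iff simp del: one_in_ring_units)
  have formula: "- (G *\<^sub>v y) \<noteq> 0\<^sub>v k \<and> unit_match n C y =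
      real (card {j. j < n \<and> right_cyclic (col G j) = right_cyclic (- (G *\<^sub>v y))})
        / real (card {smult_right (- (G *\<^sub>v y)) u | u. u \<in> ?U})"
    if y: "y \<in> carrier_vec n" and np: "\<exists>c\<in>C. c \<bullet> y \<noteq> 0" for y
  proof
    define g where "g = - (G *\<^sub>v y)"
    have g: "g \<in> carrier_vec k" using mult_mat_vec_carrier[OF G y] by (simp add: g_def)
    have Gy_g: "G *\<^sub>v y = - g" by (simp add: g_def)
    show "- (G *\<^sub>v y) \<noteq> 0\<^sub>v k"
    proof
      assume "- (G *\<^sub>v y) = 0\<^sub>v k"
      then have "G *\<^sub>v y = 0\<^sub>v k" unfolding g_def[symmetric] Gy_g by simp
      then show False using np Gy y by (auto simp: CG)
    qed
    have match: "(\<forall>c\<in>C. c \<bullet> y + c $ j * u = 0) \<longleftrightarrow> smult_right (col G j) u = g" if j: "j < n" for j u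
    proof -
      have colj: "col G j \<in> carrier_vec k" using G j by auto
      have "(\<forall>c\<in>C. c \<bullet> y + c $ j * u = 0) \<longleftrightarrow>
          (\<forall>x\<in>carrier_vec k. x \<bullet> (G *\<^sub>v y + smult_right (col G j) u) = 0)"
      proof -
        have "vec_mult_mat x G \<bullet> y + vec_mult_mat x G $ j * u = x \<bullet> (G *\<^sub>v y + smult_right (col G j) u)"
          if x: "x \<in> carrier_vec k" for x
        proof -
          have "vec_mult_mat x G $ j * u = x \<bullet> smult_right (col G j) u"
            using x colj j G by (simp add: vec_mult_mat_def scalar_prod_smult_right_distrib)
          then show ?thesis
            using x y G colj by (simp add: Gy scalar_prod_add_distrib[of _ k])
        qed
        then show ?thesis by (auto simp: CG)
      qed
      also have "\<dots> \<longleftrightarrow> G *\<^sub>v y + smult_right (col G j) u = 0\<^sub>v k"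
        by (rule scalar_prod_faithful) (use mult_mat_vec_carrier[OF G y] colj in auto)
      also have "\<dots> \<longleftrightarrow> smult_right (col G j) u = g"
        unfolding Gy_g using g G by (auto simp: vec_eq_iff add_eq_0_iff)
      finally show ?thesis .
    qed
    \<comment> \<open>Among all units, the proportion sending \<open>h\<close> to \<open>g\<close>
      is the reciprocal of the orbit size if \<open>h\<close> and \<open>g\<close> generate the same
      point, and 0 otherwise.\<close>
    have frac: "real (card {u \<in> ?U. smult_right h u = g}) / real (card ?U) =
      (if right_cyclic h = right_cyclic g then 1 / real (card {smult_right g u | u. u \<in> ?U}) else 0)" for h
    proof (cases "right_cyclic h = right_cyclic g")
      case True
      have "real (card {u \<in> ?U. smult_right h u = g}) * real (card {smult_right g u | u. u \<in> ?U}) = real (card ?U)"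
        using card_unit_fibre[OF True] by (simp flip: of_nat_mult)
      moreover have "real (card {smult_right g u | u. u \<in> ?U}) \<noteq> 0" "real (card ?U) \<noteq> 0"
        using orbit_pos[of g] card_ring_units_pos[where 'a='a] by (simp_all only: of_nat_eq_0_iff)
      ultimately show ?thesis
        using True by (simp add: frac_eq_eq)
    next
      case False
      then have "{u \<in> ?U. smult_right h u = g} = {}"
        using right_cyclic_smult_unit by auto
      with False show ?thesis by simp
    qed
    have "unit_match n C y = (\<Sum>j<n. real (card {u \<in> ?U. smult_right (col G j) u = g}) / real (card ?U))"
      unfolding unit_match_def sum_divide_distrib by (intro sum.cong refl) (simp add: match)
    also have "\<dots> = real (card {j. j < n \<and> right_cyclic (col G j) = right_cyclic g})
        / real (card {smult_right g u | u. u \<in> ?U})"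
      unfolding frac by (simp add: sum.If_cases Int_def lessThan_def)
    finally show "unit_match n C y =
      real (card {j. j < n \<and> right_cyclic (col G j) = right_cyclic (- (G *\<^sub>v y))})
        / real (card {smult_right (- (G *\<^sub>v y)) u | u. u \<in> ?U})" by (simp add: g_def)
  qed
  show vals: "unit_match n C y = 0 \<or> unit_match n C y = r"
    if y: "y \<in> carrier_vec n" and np: "\<exists>c\<in>C. c \<bullet> y \<noteq> 0" for y
  proof -
    let ?g = "- (G *\<^sub>v y)"
    have g: "?g \<in> carrier_vec k" using mult_mat_vec_carrier[OF G y] by simp
    consider "card {j. j < n \<and> right_cyclic (col G j) = right_cyclic ?g} = 0"
      | "real (card {j. j < n \<and> right_cyclic (col G j) = right_cyclic ?g}) =
          r * real (card {smult_right ?g u | u. u \<in> ?U})"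
      using pts[OF g conjunct1[OF formula[OF y np]]] by (elim disjE)
    then show ?thesis
    proof cases
      case 1
      then show ?thesis using formula[OF y np] by (simp only: of_nat_0 div_0 simp_thms)
    next
      case 2
      have "real (card {smult_right ?g u | u. u \<in> ?U}) \<noteq> 0"
        using orbit_pos[of ?g] by (simp only: of_nat_eq_0_iff)
      with 2 show ?thesis
        using formula[OF y np] by (simp only: nonzero_mult_div_cancel_right simp_thms)
    qed
  qed
  \<comment> \<open>At the unit vector of \<open>j\<close> the unit \<open>-1\<close> matches
    coordinate \<open>j\<close> itself. The count is thus positive, which excludes the value 0 and
    also forces \<open>r > 0\<close>.\<close>
  have unit: "unit_match n C (unit_vec n j) = r \<and> r > 0" if j: "j < n" for j
  proof -
    let ?e = "unit_vec n j :: 'a vec"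
    have np: "\<exists>c\<in>C. c \<bullet> ?e \<noteq> 0"
    proof -
      obtain c where c: "c \<in> C" "c $ j \<noteq> 0" using nz[OF j] by auto
      moreover have "c \<bullet> ?e = c $ j" using c(1) C'(1) j by auto
      ultimately show ?thesis by metis
    qed
    have "- 1 \<in> ?U" by (rule ring_unitsI(1)[of _ "-1"]) simp
    moreover have "c \<bullet> ?e + c $ j * - 1 = 0" if "c \<in> C" for c
      using scalar_prod_right_unit[of j n c] that C'(1) j by auto
    ultimately have "{u \<in> ?U. \<forall>c\<in>C. c \<bullet> ?e + c $ j * u = 0} \<noteq> {}" by blast
    then have "0 < real (card {u \<in> ?U. \<forall>c\<in>C. c \<bullet> ?e + c $ j * u = 0})"
      by (simp add: card_gt_0_iff)
    also have "\<dots> \<le> (\<Sum>i<n. real (card {u \<in> ?U. \<forall>c\<in>C. c \<bullet> ?e + c $ i * u = 0}))"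
      using j by (intro member_le_sum) auto
    finally have "unit_match n C ?e > 0"
      using card_ring_units_pos[where 'a='a] by (simp add: unit_match_def)
    then show ?thesis using vals[OF unit_vec_carrier np] by auto
  qed
  show "unit_match n C (unit_vec n j) = r" if "j < n" using unit[OF that] ..
  show "r > 0" if "n > 0" using unit[OF that] ..
qed

section \<open>The dual of a modular two-weight code\<close>

locale modular_two_weight =
  fixes \<chi> :: "'a::{ring_1, finite} \<Rightarrow> complex"
    and n :: nat and C :: "'a vec set" and r w1 w2 :: real and M :: "'a mat"
  assumes gen: "generating_character \<chi>"
    and two_weight: "left_two_weight_code \<chi> n C w1 w2"
    and modular: "left_modular_code n C r"
    and zero_words: "words_of_weight \<chi> C 0 = {0\<^sub>v n}"
    and M: "M \<in> carrier_mat (card (words_of_weight \<chi> C w1)) n"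
    and M_distinct: "distinct (rows M)"
    and M_rows: "set (rows M) = words_of_weight \<chi> C w1"
begin

abbreviation "C1 \<equiv> words_of_weight \<chi> C w1"
abbreviation "b1 \<equiv> card C1"
abbreviation "orth y \<equiv> \<forall>c\<in>C. c \<bullet> y = 0"
abbreviation "D \<equiv> unit_match n C"

lemma C: "left_linear_code n C"
  using two_weight by (simp add: left_two_weight_code_def)

lemmas C_simps = left_linear_codeD[OF C]

lemma ac: "additive_character \<chi>"
  using gen by (simp add: generating_character_def)

lemma finite_C: "finite C" and finite_C1: "finite C1"
  using left_linear_code_finite[OF C] by (auto simp: words_of_weight_def)

lemma weights: "w1 < w2" "w1 \<noteq> 0" "w2 \<noteq> 0"
    "\<And>c. c \<in> C \<Longrightarrow> word_weight \<chi> c \<in> {0, w1, w2}"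
    "\<exists>c\<in>C. word_weight \<chi> c = w1" "\<exists>c\<in>C. word_weight \<chi> c = w2"
proof -
  have *: "w1 < w2" "word_weight \<chi> ` C - {0} = {w1, w2}"
    using two_weight by (auto simp: left_two_weight_code_def two_weights_def)
  then have "w1 \<in> word_weight \<chi> ` C - {0}" "w2 \<in> word_weight \<chi> ` C - {0}" by auto
  then show "w1 \<noteq> 0" "w2 \<noteq> 0" "\<exists>c\<in>C. word_weight \<chi> c = w1" "\<exists>c\<in>C. word_weight \<chi> c = w2"
    by auto
  show "w1 < w2" by fact
  show "word_weight \<chi> c \<in> {0, w1, w2}" if "c \<in> C" for c using *(2) that by auto
qed

lemma word_weight_eq_0_iff: "c \<in> C \<Longrightarrow> word_weight \<chi> c = 0 \<longleftrightarrow> c = 0\<^sub>v n"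
  using zero_words by (auto simp: words_of_weight_def)

lemma C1_subset: "C1 \<subseteq> C" "C1 \<subseteq> carrier_vec n" "0\<^sub>v n \<notin> C1"
proof -
  show "C1 \<subseteq> C" by (auto simp: words_of_weight_def)
  then show "C1 \<subseteq> carrier_vec n" using C_simps(1) by blast
  show "0\<^sub>v n \<notin> C1"
    using word_weight_eq_0_iff[OF C_simps(2)] weights(2) by (auto simp: words_of_weight_def)
qed

lemma b1_pos: "b1 > 0"
  using weights(5) finite_C1 by (auto simp: card_gt_0_iff words_of_weight_def)

lemma n_pos: "n > 0"
proof (rule ccontr)
  assume "\<not> n > 0"
  moreover obtain c where c: "c \<in> C" "word_weight \<chi> c = w1" using weights(5) by auto
  moreover have "dim_vec c = n" using c(1) C_simps(1) by auto
  ultimately show False using weights(2) by (simp add: word_weight_def)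
qed

lemma w1_pos: "w1 > 0"
proof -
  obtain c where "word_weight \<chi> c = w1" using weights(5) by auto
  then have "w1 \<ge> 0" using hom_weight_nonneg[OF ac] by (auto simp: word_weight_def intro: sum_nonneg)
  then show ?thesis using weights(2) by simp
qed

lemma C_pos: "card C > 0"
  using C_simps(2) finite_C by (auto simp: card_gt_0_iff)

text \<open>Left multiplication by a unit preserves the homogeneous weight of every
  coordinate.\<close>

lemma C1_smult:
  assumes "u \<in> ring_units"
  shows "bij_betw ((\<cdot>\<^sub>v) u) C1 C1"
proof -
  obtain v where v: "v \<in> ring_units" "u * v = 1" "v * u = 1" using assms by (rule ring_unitsE)
  have cl: "w \<cdot>\<^sub>v c \<in> C1" if "w \<in> ring_units" "c \<in> C1" for w c
    using that C_simps(4) by (auto simp: words_of_weight_def word_weight_def hom_weight_unit)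
  show ?thesis
    by (rule bij_betw_byWitness[of _ "(\<cdot>\<^sub>v) v"])
      (use assms v cl in \<open>auto simp: smult_smult_assoc\<close>)
qed

definition F :: "'a vec \<Rightarrow> complex" where
  "F y = (\<Sum>c\<in>C1. \<chi> (c \<bullet> y))"

text \<open>On \<open>C\<close> the function \<open>w2 - w\<close> has the value \<open>w2\<close>
  at the zero word, \<open>w2 - w1\<close> on \<open>C1\<close> and 0 elsewhere. Its Fourier
  transform is therefore \<open>w2 + (w2 - w1) F\<close>, which is compared with the one computed by
  \<open>weight_transform\<close>.\<close>

lemma F_formula:
  assumes y: "y \<in> carrier_vec n"
  shows "of_real (w2 - w1) * F y =
    of_real (real (card C) * ((if orth y then w2 - real n else 0) + D y) - w2)"
proof -
  have add: "(c + d) \<bullet> y = c \<bullet> y + d \<bullet> y" if "c \<in> C" "d \<in> C" for c d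
    using that C_simps(1) y by (intro add_scalar_prod_distrib[of _ n]) auto
  have smult: "(a \<cdot>\<^sub>v c) \<bullet> y = a * (c \<bullet> y)" if "c \<in> C" for a c
    using that C_simps(1) y by (intro smult_scalar_prod_distrib[of _ n]) auto
  have 1: "(\<Sum>c\<in>C. \<chi> (c \<bullet> y)) = (if orth y then of_nat (card C) else 0)"
    by (rule sum_character_functional[OF gen C]) (use add smult in auto)
  have split: "of_real (w2 - word_weight \<chi> c) * \<chi> (c \<bullet> y) =
      (if c = 0\<^sub>v n then of_real w2 else 0) + (if c \<in> C1 then of_real (w2 - w1) * \<chi> (c \<bullet> y) else 0)"
    if c: "c \<in> C" for c
    using weights(4)[OF c] word_weight_eq_0_iff[OF c] c weights(1-3) y
    by (auto simp: words_of_weight_def additive_character_0[OF ac])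
  have "(\<Sum>c\<in>C. of_real (w2 - word_weight \<chi> c) * \<chi> (c \<bullet> y)) = of_real w2 + of_real (w2 - w1) * F y"
  proof -
    have "(\<Sum>c\<in>C. of_real (w2 - word_weight \<chi> c) * \<chi> (c \<bullet> y)) =
      (\<Sum>c\<in>C. if c = 0\<^sub>v n then of_real w2 else 0) +
      (\<Sum>c\<in>C. if c \<in> C1 then of_real (w2 - w1) * \<chi> (c \<bullet> y) else 0)"
      unfolding sum.distrib[symmetric] by (rule sum.cong) (use split in auto)
    also have "(\<Sum>c\<in>C. if c = 0\<^sub>v n then of_real w2 else 0) = (of_real w2 :: complex)"
      using finite_C C_simps(2) by simp
    also have "(\<Sum>c\<in>C. if c \<in> C1 then of_real (w2 - w1) * \<chi> (c \<bullet> y) else 0) = of_real (w2 - w1) * F y"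
      using C1_subset(1) by (simp add: sum.inter_restrict[OF finite_C, symmetric] Int_absorb1 F_def sum_distrib_left)
    finally show ?thesis .
  qed
  moreover have "(\<Sum>c\<in>C. of_real (w2 - word_weight \<chi> c) * \<chi> (c \<bullet> y)) =
      of_real w2 * (\<Sum>c\<in>C. \<chi> (c \<bullet> y)) - (\<Sum>c\<in>C. of_real (word_weight \<chi> c) * \<chi> (c \<bullet> y))"
    by (simp add: left_diff_distrib sum_subtractf sum_distrib_left)
  ultimately have "of_real (w2 - w1) * F y = of_real w2 * (\<Sum>c\<in>C. \<chi> (c \<bullet> y))
      - (\<Sum>c\<in>C. of_real (word_weight \<chi> c) * \<chi> (c \<bullet> y)) - of_real w2"
    by (metis add_diff_cancel_left')
  also have "\<dots> = of_real (real (card C) * ((if orth y then w2 - real n else 0) + D y) - w2)"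
    unfolding 1 weight_transform[OF gen C y] by (simp add: algebra_simps)
  finally show ?thesis .
qed

section \<open>Weights of the words of the dual\<close>

lemma word_weight_dual:
  assumes y: "y \<in> carrier_vec n"
  shows "word_weight \<chi> (M *\<^sub>v y) = (\<Sum>c\<in>C1. hom_weight \<chi> (c \<bullet> y))"
proof -
  have "word_weight \<chi> (M *\<^sub>v y) = (\<Sum>i<b1. hom_weight \<chi> (row M i \<bullet> y))"
    using M by (simp add: word_weight_def)
  also have "\<dots> = (\<Sum>c\<leftarrow>rows M. hom_weight \<chi> (c \<bullet> y))"
    using M by (simp add: rows_def sum_list_distinct_conv_sum_set lessThan_atLeast0 comp_def
        interv_sum_list_conv_sum_set_nat)
  also have "\<dots> = (\<Sum>c\<in>C1. hom_weight \<chi> (c \<bullet> y))"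
    using M_distinct by (simp add: sum_list_distinct_conv_sum_set M_rows)
  finally show ?thesis .
qed

text \<open>After exchanging the sums, a unit \<open>u\<close> can be absorbed into the word
  \<open>c\<close>. As \<open>C1\<close> is stable under units, every \<open>u\<close> contributes
  the same amount \<open>F y\<close>.\<close>

lemma word_weight_dual_F:
  assumes y: "y \<in> carrier_vec n"
  shows "of_real (word_weight \<chi> (M *\<^sub>v y)) = of_nat b1 - F y"
proof -
  let ?U = "ring_units :: 'a set"
  have "of_real (word_weight \<chi> (M *\<^sub>v y)) =
      (\<Sum>c\<in>C1. 1 - (\<Sum>u\<in>?U. \<chi> (u * (c \<bullet> y))) / of_nat (card ?U))"
    by (simp add: word_weight_dual[OF y] of_real_hom_weight[OF ac])
  also have "\<dots> = of_nat b1 - (\<Sum>u\<in>?U. \<Sum>c\<in>C1. \<chi> (u * (c \<bullet> y))) / of_nat (card ?U)"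
    by (simp add: sum_subtractf sum_divide_distrib[symmetric] sum.swap[of _ C1])
  also have "(\<Sum>u\<in>?U. \<Sum>c\<in>C1. \<chi> (u * (c \<bullet> y))) = (\<Sum>u\<in>?U. F y)"
  proof (rule sum.cong)
    fix u assume u: "u \<in> ?U"
    have "(\<Sum>c\<in>C1. \<chi> (u * (c \<bullet> y))) = (\<Sum>c\<in>C1. \<chi> ((u \<cdot>\<^sub>v c) \<bullet> y))"
      using C1_subset(2) y by (intro sum.cong) (auto simp: smult_scalar_prod_distrib[of _ n])
    then show "(\<Sum>c\<in>C1. \<chi> (u * (c \<bullet> y))) = F y"
      using sum.reindex_bij_betw[OF C1_smult[OF u], of "\<lambda>c. \<chi> (c \<bullet> y)"] by (simp add: F_def)
  qed simp
  finally show ?thesis using card_ring_units_pos[where 'a='a] by (auto split: if_splits)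
qed

lemma F_orth: "orth y \<Longrightarrow> F y = of_nat b1"
  using C1_subset(1) by (auto simp: F_def additive_character_0[OF ac] subset_iff)

text \<open>This is \<open>F_formula\<close> at \<open>y = 0\<close>, where \<open>F\<close> equals
  \<open>b1\<close> and \<open>D\<close> vanishes.\<close>

lemma b1_formula: "(w2 - w1) * real b1 = real (card C) * (w2 - real n) - w2"
proof -
  have orth: "orth (0\<^sub>v n)" using C_simps(1) by auto
  have "of_real ((w2 - w1) * real b1) = (of_real (real (card C) * (w2 - real n) - w2) :: complex)"
    using F_formula[OF zero_carrier_vec] F_orth[OF orth] unit_match_modular(2)[OF modular orth] orth
    by simp
  then show ?thesis by (simp only: of_real_eq_iff)
qed

text \<open>Subtracting \<open>F_formula\<close> from \<open>b1_formula\<close> cancels the constant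
  \<open>w2\<close>.\<close>

lemma word_weight_dual_value:
  assumes y: "y \<in> carrier_vec n" and "\<not> orth y"
  shows "word_weight \<chi> (M *\<^sub>v y) = (w2 - real n - D y) * real (card C) / (w2 - w1)"
proof -
  have "of_real ((w2 - w1) * word_weight \<chi> (M *\<^sub>v y)) = of_real ((w2 - w1) * real b1) - of_real (w2 - w1) * F y"
    by (simp add: word_weight_dual_F[OF y] right_diff_distrib)
  also have "\<dots> = of_real ((w2 - real n - D y) * real (card C))"
    unfolding F_formula[OF y] b1_formula if_not_P[OF assms(2)] by (simp add: algebra_simps)
  finally have "(w2 - w1) * word_weight \<chi> (M *\<^sub>v y) = (w2 - real n - D y) * real (card C)"
    by (simp only: of_real_eq_iff)
  then show ?thesis using weights(1) by (simp add: field_simps)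
qed

lemma dual_eq_0:
  assumes "orth y"
  shows "M *\<^sub>v y = 0\<^sub>v b1"
proof (rule eq_vecI)
  fix i assume "i < dim_vec (0\<^sub>v b1 :: 'a vec)"
  then have i: "i < b1" by simp
  then have "row M i \<in> set (rows M)" using M by (auto simp: rows_def)
  then have "row M i \<in> C" using M_rows C1_subset(1) by auto
  then show "(M *\<^sub>v y) $ i = 0\<^sub>v b1 $ i" using assms i M by simp
qed (use M in simp)

lemma word_weight_0: "word_weight \<chi> (0\<^sub>v m) = 0"
  by (simp add: word_weight_def hom_weight_0[OF ac])

lemma unit_vec_not_orth: "j < n \<Longrightarrow> \<not> orth (unit_vec n j)"
  using modular C_simps(1) unfolding left_modular_code_def no_zero_coordinate_def
  by (metis scalar_prod_right_unit)

text \<open>The entries of \<open>M\<close> are weighed in two ways: each of the \<open>n\<close>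
  columns has the weight on the left-hand side, and each of the \<open>b1\<close> rows has weight
  \<open>w1\<close>.\<close>

lemma w1'_alt: "(w2 - real n - r) * real (card C) / (w2 - w1) = real b1 * w1 / real n"
proof -
  let ?w = "(w2 - real n - r) * real (card C) / (w2 - w1)"
  have "word_weight \<chi> (M *\<^sub>v unit_vec n j) = ?w" if "j < n" for j
    using word_weight_dual_value[OF unit_vec_carrier unit_vec_not_orth[OF that]]
      unit_match_modular(3)[OF modular that] by simp
  then have "real n * ?w = (\<Sum>j<n. word_weight \<chi> (M *\<^sub>v unit_vec n j))"
    by simp
  also have "\<dots> = (\<Sum>c\<in>C1. \<Sum>j<n. hom_weight \<chi> (c \<bullet> unit_vec n j))"
    unfolding word_weight_dual[OF unit_vec_carrier] by (rule sum.swap)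
  also have "\<dots> = (\<Sum>c\<in>C1. w1)"
  proof (rule sum.cong)
    fix c assume c: "c \<in> C1"
    then have "dim_vec c = n" using C1_subset(2) by auto
    moreover have "(\<Sum>j<n. hom_weight \<chi> (c \<bullet> unit_vec n j)) = (\<Sum>j<n. hom_weight \<chi> (c $ j))"
      by (rule sum.cong) simp_all
    ultimately show "(\<Sum>j<n. hom_weight \<chi> (c \<bullet> unit_vec n j)) = w1"
      using c by (simp add: words_of_weight_def word_weight_def)
  qed simp
  finally show ?thesis using n_pos by (simp add: field_simps)
qed

text \<open>If \<open>D\<close> took only the value \<open>r\<close> off the orthogonal of \<open>C\<close>, then \<open>F\<close> would be constant there,
  and Fourier inversion would make the indicator of \<open>C1\<close> constant on the nonzero words of \<open>C\<close>.\<close>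

lemma unit_match_0_attained: "\<exists>y\<in>carrier_vec n. \<not> orth y \<and> D y = 0"
proof (rule ccontr)
  assume no: "\<not> (\<exists>y\<in>carrier_vec n. \<not> orth y \<and> D y = 0)"
  let ?V = "carrier_vec n :: 'a vec set"
  \<comment> \<open>The value that \<open>F_formula\<close> gives off the orthogonal of
    \<open>C\<close> when \<open>D y = r\<close>.\<close>
  define d :: complex where "d = of_real ((real (card C) * r - w2) / (w2 - w1))"
  have F: "F y = d" if y: "y \<in> ?V" "\<not> orth y" for y
  proof -
    have "D y = r" using unit_match_modular(1)[OF modular] no y by blast
    then have "of_real (w2 - w1) * F y = of_real (w2 - w1) * d"
      using F_formula[OF y(1)] y(2) weights(1) by (simp add: d_def)
    then show ?thesis using weights(1) by simp
  qed
  \<comment> \<open>Off the orthogonal the factor \<open>F y - d\<close> is zero, and on it the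
    twist by \<open>c\<close> is trivial, so the sum is the same for all \<open>c\<close> in
    \<open>C\<close>.\<close>
  have indep: "(\<Sum>y\<in>?V. (F y - d) * \<chi> (- (c \<bullet> y))) = (\<Sum>y\<in>?V. if orth y then F y - d else 0)"
    if "c \<in> C" for c
    using that by (intro sum.cong) (auto simp: F additive_character_0[OF ac])
  \<comment> \<open>Fourier inversion over the whole space recovers the indicator of
    \<open>C1\<close>; the constant \<open>d\<close> drops out because \<open>c\<close> is
    nonzero.\<close>
  have inv: "(\<Sum>y\<in>?V. (F y - d) * \<chi> (- (c \<bullet> y))) = (if c \<in> C1 then of_nat (card ?V) else 0)"
    if c: "c \<in> C" "c \<noteq> 0\<^sub>v n" for c
  proof -
    have cV: "c \<in> ?V" using c C_simps(1) by auto
    have "(\<Sum>y\<in>?V. (F y - d) * \<chi> (- (c \<bullet> y))) =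
        (\<Sum>y\<in>?V. \<Sum>c'\<in>C1. \<chi> ((c' - c) \<bullet> y)) - d * (\<Sum>y\<in>?V. \<chi> ((- c) \<bullet> y))"
      unfolding sum_distrib_left sum_subtractf[symmetric]
    proof (rule sum.cong)
      fix y :: "'a vec" assume y: "y \<in> ?V"
      have "\<chi> (c' \<bullet> y) * \<chi> (- (c \<bullet> y)) = \<chi> ((c' - c) \<bullet> y)" if "c' \<in> C1" for c'
      proof -
        have "c' \<in> ?V" using that C1_subset(2) by auto
        then show ?thesis
          using minus_scalar_prod_distrib[of c' n c y] cV y by (simp add: additive_character_simps[OF ac])
      qed
      moreover have "(- c) \<bullet> y = - (c \<bullet> y)" using cV y by simp
      ultimately show "(F y - d) * \<chi> (- (c \<bullet> y)) = (\<Sum>c'\<in>C1. \<chi> ((c' - c) \<bullet> y)) - d * \<chi> ((- c) \<bullet> y)"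
        by (simp add: F_def left_diff_distrib sum_distrib_right)
    qed simp
    also have "(\<Sum>y\<in>?V. \<chi> ((- c) \<bullet> y)) = 0"
      using sum_character_vec[OF gen, of "- c" n] cV c(2) by (simp add: uminus_zero_vec_eq)
    also have "(\<Sum>y\<in>?V. \<Sum>c'\<in>C1. \<chi> ((c' - c) \<bullet> y)) = (\<Sum>c'\<in>C1. \<Sum>y\<in>?V. \<chi> ((c' - c) \<bullet> y))"
      by (rule sum.swap)
    also have "\<dots> = (\<Sum>c'\<in>C1. if c' = c then of_nat (card ?V) else 0)"
    proof (rule sum.cong)
      fix c' assume "c' \<in> C1"
      then have c': "c' \<in> ?V" using C1_subset(2) by auto
      then have "c' - c = 0\<^sub>v n \<longleftrightarrow> c' = c" using cV by (auto simp: vec_eq_iff)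
      then show "(\<Sum>y\<in>?V. \<chi> ((c' - c) \<bullet> y)) = (if c' = c then of_nat (card ?V) else 0)"
        using sum_character_vec[OF gen, of "c' - c" n] c' cV by simp
    qed simp
    finally show ?thesis using finite_C1 by simp
  qed
  \<comment> \<open>A word of weight \<open>w1\<close> and one of weight \<open>w2\<close> give
    different values in \<open>inv\<close> but the same value in \<open>indep\<close>.\<close>
  obtain c1 where c1: "c1 \<in> C" "word_weight \<chi> c1 = w1" using weights(5) by auto
  obtain c2 where c2: "c2 \<in> C" "word_weight \<chi> c2 = w2" using weights(6) by auto
  have nz: "c1 \<noteq> 0\<^sub>v n" "c2 \<noteq> 0\<^sub>v n" "c1 \<in> C1" "c2 \<notin> C1"
    using c1 c2 weights word_weight_0 by (auto simp: words_of_weight_def)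
  have "(of_nat (card ?V) :: complex) = 0"
    using inv[OF c1(1) nz(1)] inv[OF c2(1) nz(2)] indep[OF c1(1)] indep[OF c2(1)] nz(3,4) by simp
  moreover have "card ?V > 0"
    using finite_carrier_vec[of n] zero_carrier_vec[of n] by (auto simp only: card_gt_0_iff)
  ultimately show False by simp
qed

section \<open>The dual as a modular two-weight code\<close>

abbreviation "C' \<equiv> {M *\<^sub>v y | y. y \<in> carrier_vec n}"

text \<open>Off the orthogonal of \<open>C\<close>, \<open>D = r\<close> yields \<open>w1'\<close>
  and \<open>D = 0\<close> yields \<open>w2'\<close>. Both are positive: \<open>w1'\<close> by its
  second expression, and \<open>w2'\<close> because it exceeds \<open>w1'\<close> by
  \<open>r |C| / (w2 - w1)\<close>. So a dual word of weight 0 comes from an orthogonal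
  \<open>y\<close>, and then it is the zero word.\<close>

lemma dual_weights:
  defines "w1' \<equiv> (w2 - real n - r) * real (card C) / (w2 - w1)"
    and "w2' \<equiv> (w2 - real n) * real (card C) / (w2 - w1)"
  shows "two_weights \<chi> C' w1' w2'" "words_of_weight \<chi> C' 0 = {0\<^sub>v b1}"
proof -
  have "w1' > 0" unfolding w1'_def w1'_alt using b1_pos w1_pos n_pos by simp
  moreover have "w2' - w1' = r * real (card C) / (w2 - w1)"
    by (simp add: w1'_def w2'_def diff_divide_distrib[symmetric] algebra_simps)
  then have lt: "w1' < w2'"
    using unit_match_modular(4)[OF modular n_pos] C_pos weights(1)
    by (metis diff_gt_0_iff_gt divide_pos_pos mult_pos_pos of_nat_0_less_iff)
  ultimately have nz: "w1' \<noteq> 0" "w2' \<noteq> 0" by auto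
  have val: "word_weight \<chi> (M *\<^sub>v y) \<in> {w1', w2'}" if y: "y \<in> carrier_vec n" "\<not> orth y" for y
    using unit_match_modular(1)[OF modular y(1)] y
    by (auto simp: word_weight_dual_value w1'_def w2'_def)
  have w1': "\<exists>y\<in>carrier_vec n. word_weight \<chi> (M *\<^sub>v y) = w1'"
    using word_weight_dual_value[OF unit_vec_carrier unit_vec_not_orth[OF n_pos]]
      unit_match_modular(3)[OF modular n_pos] unit_vec_carrier unfolding w1'_def by metis
  have w2': "\<exists>y\<in>carrier_vec n. word_weight \<chi> (M *\<^sub>v y) = w2'"
    using unit_match_0_attained word_weight_dual_value unfolding w2'_def by (metis diff_zero)
  have zero: "word_weight \<chi> (M *\<^sub>v y) = 0" if "orth y" for y
    using dual_eq_0[OF that] word_weight_0 by simp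
  show "two_weights \<chi> C' w1' w2'"
    unfolding two_weights_def
  proof (intro conjI equalityI subsetI)
    show "w1' < w2'" by (rule lt)
    show "x \<in> {w1', w2'}" if "x \<in> word_weight \<chi> ` C' - {0}" for x
      using that val zero by blast
    show "x \<in> word_weight \<chi> ` C' - {0}" if "x \<in> {w1', w2'}" for x
      using that w1' w2' nz by auto
  qed
  show "words_of_weight \<chi> C' 0 = {0\<^sub>v b1}"
  proof (intro equalityI subsetI)
    fix x assume "x \<in> words_of_weight \<chi> C' 0"
    then obtain y where "y \<in> carrier_vec n" "x = M *\<^sub>v y" "word_weight \<chi> (M *\<^sub>v y) = 0"
      by (auto simp: words_of_weight_def)
    then show "x \<in> {0\<^sub>v b1}" using val nz dual_eq_0 by (metis insert_iff empty_iff)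
  next
    fix x :: "'a vec" assume x: "x \<in> {0\<^sub>v b1}"
    have orth: "orth (0\<^sub>v n)" using C_simps(1) by auto
    have "x = M *\<^sub>v 0\<^sub>v n" using x dual_eq_0[OF orth] by simp
    moreover have "word_weight \<chi> (M *\<^sub>v 0\<^sub>v n) = 0" using orth by (rule zero)
    ultimately show "x \<in> words_of_weight \<chi> C' 0"
      unfolding words_of_weight_def using zero_carrier_vec[of n] by blast
  qed
qed

lemma dual_modular: "right_modular_code b1 C' 1"
  unfolding right_modular_code_def
proof (intro conjI)
  show "right_linear_code b1 C'" by (rule right_linear_code_range[OF M])
  have row_C1: "row M i \<in> C1" if "i < b1" for i
    using that M M_rows by (auto simp: rows_def)
  show "no_zero_coordinate b1 C'"
    unfolding no_zero_coordinate_def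
  proof (intro allI impI)
    fix i assume i: "i < b1"
    \<comment> \<open>Coordinate \<open>i\<close> of the dual is read off from row \<open>i\<close>
      of \<open>M\<close>, a nonzero word because \<open>w1\<close> is nonzero; a unit vector picks
      out one of its nonzero entries.\<close>
    have "row M i \<in> carrier_vec n" "row M i \<noteq> 0\<^sub>v n" using row_C1[OF i] C1_subset by auto
    then obtain j where j: "j < n" "row M i $ j \<noteq> 0"
      by (metis carrier_vecD eq_vecI index_zero_vec)
    have "(M *\<^sub>v unit_vec n j) $ i \<noteq> 0" using i j M by simp
    then show "\<exists>c\<in>C'. c $ i \<noteq> 0" using unit_vec_carrier by blast
  qed
  show "\<exists>k. \<exists>H\<in>carrier_mat b1 k. C' = {H *\<^sub>v y | y. y \<in> carrier_vec k} \<and>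
       (\<forall>h \<in> carrier_vec k. h \<noteq> 0\<^sub>v k \<longrightarrow>
          (let \<alpha> = card {j. j < b1 \<and> left_cyclic (row H j) = left_cyclic h}
           in \<alpha> = 0 \<or> real \<alpha> = 1 * real (card {u \<cdot>\<^sub>v h | u. u \<in> ring_units})))"
  proof (intro exI[of _ n] bexI[OF _ M] conjI ballI impI refl)
    fix h :: "'a vec"
    let ?J = "{j. j < b1 \<and> left_cyclic (row M j) = left_cyclic h}"
    let ?O = "{u \<cdot>\<^sub>v h | u. u \<in> ring_units}"
    \<comment> \<open>If some row generates the point of \<open>h\<close>, then \<open>h\<close> is
      a unit multiple of that row and itself lies in \<open>C1\<close>. The rows generating this
      point are then exactly the unit multiples of \<open>h\<close>, and each occurs once because
      the rows are distinct.\<close>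
    have "card ?J = card ?O" if ne: "?J \<noteq> {}"
    proof (rule bij_betw_same_card)
      obtain j0 where j0: "j0 < b1" "left_cyclic (row M j0) = left_cyclic h" using ne by auto
      obtain u0 where u0: "u0 \<in> ring_units" "h = u0 \<cdot>\<^sub>v row M j0"
        using j0(2) by (rule left_cyclic_eq_imp_unit)
      have h: "h \<in> C1"
        using bij_betwE[OF C1_smult[OF u0(1)]] row_C1[OF j0(1)] u0(2) by auto
      have inj: "inj_on (row M) {..<b1}"
        using M_distinct M by (auto simp: rows_def distinct_map lessThan_atLeast0)
      show "bij_betw (row M) ?J ?O"
        unfolding bij_betw_def
      proof (intro conjI equalityI subsetI)
        show "inj_on (row M) ?J" by (rule inj_on_subset[OF inj]) auto
        show "x \<in> ?O" if "x \<in> row M ` ?J" for x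
        proof -
          obtain j where j: "x = row M j" "left_cyclic h = left_cyclic (row M j)"
            using \<open>x \<in> row M ` ?J\<close> by auto
          obtain u where "u \<in> ring_units" "row M j = u \<cdot>\<^sub>v h"
            using j(2) by (rule left_cyclic_eq_imp_unit)
          then show ?thesis using j by auto
        qed
        show "x \<in> row M ` ?J" if "x \<in> ?O" for x
        proof -
          obtain u where u: "u \<in> ring_units" "x = u \<cdot>\<^sub>v h" using \<open>x \<in> ?O\<close> by auto
          then have "x \<in> set (rows M)" using bij_betwE[OF C1_smult[OF u(1)]] h M_rows by auto
          then obtain j where "j < b1" "x = row M j" using M by (auto simp: rows_def)
          then show ?thesis using left_cyclic_smult_unit[OF u(1), of h] u(2) by auto
        qed
      qed
    qed
    then show "let \<alpha> = card ?J in \<alpha> = 0 \<or> real \<alpha> = 1 * real (card ?O)"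
      by (cases "?J = {}") (auto simp: Let_def simp del: Collect_empty_eq)
  qed
qed simp

end

theorem theorem15:
  fixes \<chi> :: "'a::{ring_1, finite} \<Rightarrow> complex"
    and n b1 :: nat
    and C C' :: "'a vec set"
    and r w1 w2 w1' w2' :: real
  assumes "frobenius_ring TYPE('a)"
    and "generating_character \<chi>"
    and "left_two_weight_code \<chi> n C w1 w2"
    and "left_modular_code n C r"
    and "words_of_weight \<chi> C 0 = {0\<^sub>v n}"
    and "b1 = card (words_of_weight \<chi> C w1)"
    and "is_two_weight_dual \<chi> n C w1 C'"
    and "w1' = (w2 - real n - r) * real (card C) / (w2 - w1)"
    and "w2' = (w2 - real n) * real (card C) / (w2 - w1)"
  shows "right_two_weight_code \<chi> b1 C' w1' w2' \<and>
         (\<exists>r'. right_modular_code b1 C' r') \<and>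
         words_of_weight \<chi> C' 0 = {0\<^sub>v b1} \<and>
         w1' = real b1 * w1 / real n"
proof -
  obtain N where N: "N \<in> carrier_mat (card (words_of_weight \<chi> C w1)) n" "distinct (rows N)"
      "set (rows N) = words_of_weight \<chi> C w1" "C' = right_column_code N"
    using assms(7) unfolding is_two_weight_dual_def by blast
  interpret modular_two_weight \<chi> n C r w1 w2 N
    using assms N by unfold_locales
  have C': "C' = {N *\<^sub>v y | y. y \<in> carrier_vec n}"
    using N(4) right_column_code_eq_range[OF N(1)] by simp
  show ?thesis
    unfolding C' assms(6,8,9) right_two_weight_code_def
    using right_linear_code_range[OF N(1)] dual_weights dual_modular w1'_alt by blast
qed

end
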